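(* Let $k\ge1$ and let $\Lambda$ be a row-finite and cofinal $k$-graph with no sources, with coordinate matrices $A_{e_1},\dots,A_{e_k}$. Then the following are equivalent: (1) $S(\Lambda)$ is stably finite; (2) $(n+1)x\not\le nx$ for any nonzero $x\in S(\Lambda)$ and $n\in\mathbb{N}$; (3) $S(\Lambda)$ admits a nontrivial state; (4) $\big(\sum_{i=1}^k\mathrm{im}(1-A^t_{e_i})\big)\cap\mathbb{N}\Lambda^0=\{0\}$; and (5) $\Lambda$ admits a faithful graph trace.
   Context: $\mathbb{N}=\{0,1,2,\dots\}$, and $e_1,\dots,e_k$ are the standard generators of $\mathbb{N}^k$. A $k$-graph is a nonempty countable small category $\Lambda$ with a functor $d\colon\Lambda\to\mathbb{N}^k$ such that whenever $d(\lambda)=m+n$ there are unique $\mu,\nu\in\Lambda$ with $d(\mu)=m$, $d(\nu)=n$, $\lambda=\mu\nu$. $\Lambda^n=d^{-1}(n)$; $\Lambda^0$ is the set of vertices (identity morphisms); $r(\lambda),s(\lambda)\in\Lambda^0$ are the codomain and domain of $\lambda$. For $v,w\in\Lambda^0$: $v\Lambda=\{\lambda:r(\lambda)=v\}$, $v\Lambda^n=v\Lambda\cap\Lambda^n$, $v\Lambda^nw=\{\lambda\in v\Lambda^n:s(\lambda)=w\}$. $\Lambda$ is row-finite if every $v\Lambda^n$ is finite, has no sources if every $v\Lambda^n$ is nonempty, and is cofinal if for all $v,w\in\Lambda^0$ there is $n\in\mathbb{N}^k$ with $s(w\Lambda^n)\subseteq s(v\Lambda)$. The coordinate matrices are $A_{e_i}(u,v)=|u\Lambda^{e_i}v|$.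 For $n\in\mathbb{N}^k$, $A_n^t$ acts on the group $\mathbb{Z}\Lambda^0$ of finitely supported functions $\Lambda^0\to\mathbb{Z}$ by $A_n^t\delta_v=\sum_{\lambda\in v\Lambda^n}\delta_{s(\lambda)}$; $\mathrm{im}(1-A_{e_i}^t)\subseteq\mathbb{Z}\Lambda^0$, and $\mathbb{N}\Lambda^0\subseteq\mathbb{Z}\Lambda^0$ is the set of $\mathbb{N}$-valued functions. The semigroup $S(\Lambda)$: for $x,y\in\mathbb{N}\Lambda^0$ write $x\sim_\Lambda y$ if $A_p^tx=A_q^ty$ for some $p,q\in\mathbb{N}^k$. Write $f\approx_\Lambda g$ if there are finitely many $x_i,y_i\in\mathbb{N}\Lambda^0$ with $f\sim_\Lambda\sum_ix_i$, $g\sim_\Lambda\sum_iy_i$ and $x_i\sim_\Lambda y_i$ for all $i$. Then $\approx_\Lambda$ is an equivalence relation and $S(\Lambda)=\mathbb{N}\Lambda^0/\!\approx_\Lambda$ is an abelian semigroup with identity under $[f]_\Lambda+[g]_\Lambda=[f+g]_\Lambda$, with the algebraic preorder ($a\le b$ iff $a+c=b$ for some $c$). In a preordered abelian semigroup $S$ with identity, a nonzero $x$ is infinite if $x+y=x$ for some nonzero $y\in S$; $S$ is stably finite if it has no infinite elements. A state on $S$ is a map $f\colon S\to[0,\infty]$ that respects $+$ and $\le$ and has $f(0)=0$; it is nontrivial if it takes a value different from $0$ and $\infty$. A faithful graph trace on $\Lambda$ is a function $\tau\colon\Lambda^0\to(0,\infty)$ with $\tau(v)=\sum_{\lambda\in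 v\Lambda^n}\tau(s(\lambda))$ for all $v\in\Lambda^0$, $n\in\mathbb{N}^k$. *)

theory Defs
  imports "HOL-Analysis.Analysis" "HOL-Algebra.Group" "HOL-Library.Poly_Mapping"
    "HOL-Library.Set_Algebras"
begin

section \<open>Higher-rank graphs\<close>

text \<open>The rank \<open>k \<ge> 1\<close> is the cardinality of the finite index type \<open>'k\<close>, degrees live in
  \<open>nat ^ 'k\<close>, and \<open>e\<^sub>i\<close> is \<open>axis i 1\<close>.  A small category is given by its set of morphisms alone:
  objects are identified with their identity morphisms, so that range (codomain) and source (domain)
  are maps from morphisms to morphisms.  Composition \<open>\<mu> \<cdot> \<nu>\<close> is only meaningful when
  the source of \<open>\<mu>\<close> is the range of \<open>\<nu>\<close>.\<close>

record ('a, 'k) kgraph_data =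
  paths :: "'a set"
  rg :: "'a \<Rightarrow> 'a"
  sr :: "'a \<Rightarrow> 'a"
  cmp :: "'a \<Rightarrow> 'a \<Rightarrow> 'a"  (infixl \<open>\<cdot>\<index>\<close> 70)
  deg :: "'a \<Rightarrow> nat ^ 'k"

locale small_category =
  fixes \<Lambda> :: "('a, 'k::finite) kgraph_data" (structure)
  assumes rg_closed: "\<kappa> \<in> paths \<Lambda> \<Longrightarrow> rg \<Lambda> \<kappa> \<in> paths \<Lambda>"
    and sr_closed: "\<kappa> \<in> paths \<Lambda> \<Longrightarrow> sr \<Lambda> \<kappa> \<in> paths \<Lambda>"
    and cmp_closed: "\<lbrakk>\<mu> \<in> paths \<Lambda>; \<nu> \<in> paths \<Lambda>; sr \<Lambda> \<mu> = rg \<Lambda> \<nu>\<rbrakk> \<Longrightarrow> \<mu> \<cdot> \<nu> \<in> paths \<Lambda>"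
    and sr_rg: "\<kappa> \<in> paths \<Lambda> \<Longrightarrow> sr \<Lambda> (rg \<Lambda> \<kappa>) = rg \<Lambda> \<kappa>"
    and rg_sr: "\<kappa> \<in> paths \<Lambda> \<Longrightarrow> rg \<Lambda> (sr \<Lambda> \<kappa>) = sr \<Lambda> \<kappa>"
    and rg_cmp: "\<lbrakk>\<mu> \<in> paths \<Lambda>; \<nu> \<in> paths \<Lambda>; sr \<Lambda> \<mu> = rg \<Lambda> \<nu>\<rbrakk> \<Longrightarrow> rg \<Lambda> (\<mu> \<cdot> \<nu>) = rg \<Lambda> \<mu>"
    and sr_cmp: "\<lbrakk>\<mu> \<in> paths \<Lambda>; \<nu> \<in> paths \<Lambda>; sr \<Lambda> \<mu> = rg \<Lambda> \<nu>\<rbrakk> \<Longrightarrow> sr \<Lambda> (\<mu> \<cdot> \<nu>) = sr \<Lambda> \<nu>"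
    and id_left: "\<kappa> \<in> paths \<Lambda> \<Longrightarrow> rg \<Lambda> \<kappa> \<cdot> \<kappa> = \<kappa>"
    and id_right: "\<kappa> \<in> paths \<Lambda> \<Longrightarrow> \<kappa> \<cdot> sr \<Lambda> \<kappa> = \<kappa>"
    and cmp_assoc: "\<lbrakk>\<kappa> \<in> paths \<Lambda>; \<mu> \<in> paths \<Lambda>; \<nu> \<in> paths \<Lambda>; sr \<Lambda> \<kappa> = rg \<Lambda> \<mu>; sr \<Lambda> \<mu> = rg \<Lambda> \<nu>\<rbrakk>
        \<Longrightarrow> (\<kappa> \<cdot> \<mu>) \<cdot> \<nu> = \<kappa> \<cdot> (\<mu> \<cdot> \<nu>)"

locale kgraph = small_category +
  assumes nonempty: "paths \<Lambda> \<noteq> {}"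
    and countable_paths: "countable (paths \<Lambda>)"
    and deg_rg: "\<kappa> \<in> paths \<Lambda> \<Longrightarrow> deg \<Lambda> (rg \<Lambda> \<kappa>) = 0"
    and deg_cmp: "\<lbrakk>\<mu> \<in> paths \<Lambda>; \<nu> \<in> paths \<Lambda>; sr \<Lambda> \<mu> = rg \<Lambda> \<nu>\<rbrakk>
        \<Longrightarrow> deg \<Lambda> (\<mu> \<cdot> \<nu>) = deg \<Lambda> \<mu> + deg \<Lambda> \<nu>"
    and unique_factorization: "\<lbrakk>\<kappa> \<in> paths \<Lambda>; deg \<Lambda> \<kappa> = m + n\<rbrakk>
        \<Longrightarrow> \<exists>!(\<mu>, \<nu>). \<mu> \<in> paths \<Lambda> \<and> \<nu> \<in> paths \<Lambda> \<and> sr \<Lambda> \<mu> = rg \<Lambda> \<nu> \<and>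
               deg \<Lambda> \<mu> = m \<and> deg \<Lambda> \<nu> = n \<and> \<kappa> = \<mu> \<cdot> \<nu>"

definition paths_deg :: "('a, 'k::finite) kgraph_data \<Rightarrow> nat ^ 'k \<Rightarrow> 'a set" where
  "paths_deg \<Lambda> n = {\<kappa> \<in> paths \<Lambda>. deg \<Lambda> \<kappa> = n}"

abbreviation vertices :: "('a, 'k::finite) kgraph_data \<Rightarrow> 'a set" where
  "vertices \<Lambda> \<equiv> paths_deg \<Lambda> 0"

lemma (in kgraph) vertices_eq_identities: "vertices \<Lambda> = rg \<Lambda> ` paths \<Lambda>"
proof
  show "rg \<Lambda> ` paths \<Lambda> \<subseteq> vertices \<Lambda>"
    by (auto simp: paths_deg_def rg_closed deg_rg)
  show "vertices \<Lambda> \<subseteq> rg \<Lambda> ` paths \<Lambda>"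
  proof
    fix \<kappa> assume "\<kappa> \<in> vertices \<Lambda>"
    then have l: "\<kappa> \<in> paths \<Lambda>" "deg \<Lambda> \<kappa> = 0 + 0" by (auto simp: paths_deg_def)
    have s: "deg \<Lambda> (sr \<Lambda> \<kappa>) = 0" using deg_rg[OF sr_closed[OF l(1)]] rg_sr[OF l(1)] by simp
    let ?P = "\<lambda>(\<mu>, \<nu>). \<mu> \<in> paths \<Lambda> \<and> \<nu> \<in> paths \<Lambda> \<and> sr \<Lambda> \<mu> = rg \<Lambda> \<nu> \<and>
      deg \<Lambda> \<mu> = 0 \<and> deg \<Lambda> \<nu> = 0 \<and> \<kappa> = \<mu> \<cdot> \<nu>"
    have "?P (rg \<Lambda> \<kappa>, \<kappa>)" "?P (\<kappa>, sr \<Lambda> \<kappa>)"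
      using l s by (simp_all add: rg_closed sr_closed sr_rg rg_sr deg_rg id_left id_right)
    then have "(rg \<Lambda> \<kappa>, \<kappa>) = (\<kappa>, sr \<Lambda> \<kappa>)"
      using unique_factorization[OF l] by (elim ex1E) (blast intro: trans sym)
    then show "\<kappa> \<in> rg \<Lambda> ` paths \<Lambda>" using l(1) by force
  qed
qed

text \<open>\<open>v\<Lambda>\<close> and \<open>v\<Lambda>\<^sup>n\<close>\<close>

definition paths_from :: "('a, 'k::finite) kgraph_data \<Rightarrow> 'a \<Rightarrow> 'a set" where
  "paths_from \<Lambda> v = {\<kappa> \<in> paths \<Lambda>. rg \<Lambda> \<kappa> = v}"

definition paths_from_deg :: "('a, 'k::finite) kgraph_data \<Rightarrow> 'a \<Rightarrow> nat ^ 'k \<Rightarrow> 'a set" where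
  "paths_from_deg \<Lambda> v n = paths_from \<Lambda> v \<inter> paths_deg \<Lambda> n"

definition row_finite :: "('a, 'k::finite) kgraph_data \<Rightarrow> bool" where
  "row_finite \<Lambda> \<longleftrightarrow> (\<forall>v \<in> vertices \<Lambda>. \<forall>n. finite (paths_from_deg \<Lambda> v n))"

definition no_sources :: "('a, 'k::finite) kgraph_data \<Rightarrow> bool" where
  "no_sources \<Lambda> \<longleftrightarrow> (\<forall>v \<in> vertices \<Lambda>. \<forall>n. paths_from_deg \<Lambda> v n \<noteq> {})"

definition kgraph_cofinal :: "('a, 'k::finite) kgraph_data \<Rightarrow> bool" where
  "kgraph_cofinal \<Lambda> \<longleftrightarrow> (\<forall>v \<in> vertices \<Lambda>. \<forall>w \<in> vertices \<Lambda>. \<exists>n.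
     sr \<Lambda> ` paths_from_deg \<Lambda> w n \<subseteq> sr \<Lambda> ` paths_from \<Lambda> v)"

definition coord_matrix :: "('a, 'k::finite) kgraph_data \<Rightarrow> nat ^ 'k \<Rightarrow> 'a \<Rightarrow> 'a \<Rightarrow> nat" where
  "coord_matrix \<Lambda> n u v = card {\<kappa> \<in> paths_from_deg \<Lambda> u n. sr \<Lambda> \<kappa> = v}"

definition faithful_graph_trace :: "('a, 'k::finite) kgraph_data \<Rightarrow> ('a \<Rightarrow> real) \<Rightarrow> bool" where
  "faithful_graph_trace \<Lambda> \<tau> \<longleftrightarrow> (\<forall>v \<in> vertices \<Lambda>. 0 < \<tau> v) \<and>
     (\<forall>v \<in> vertices \<Lambda>. \<forall>n. \<tau> v = (\<Sum>\<kappa> \<in> paths_from_deg \<Lambda> v n. \<tau> (sr \<Lambda> \<kappa>)))"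


section \<open>The action on \<open>\<int>\<Lambda>\<^sup>0\<close> and the semigroup of a higher-rank graph\<close>

definition ZV :: "('a, 'k::finite) kgraph_data \<Rightarrow> ('a \<Rightarrow>\<^sub>0 int) set" where
  "ZV \<Lambda> = {f. Poly_Mapping.keys f \<subseteq> vertices \<Lambda>}"

definition NV :: "('a, 'k::finite) kgraph_data \<Rightarrow> ('a \<Rightarrow>\<^sub>0 int) set" where
  "NV \<Lambda> = {f \<in> ZV \<Lambda>. \<forall>v. 0 \<le> Poly_Mapping.lookup f v}"

text \<open>The additive extension of \<open>\<delta>\<^sub>v \<mapsto> \<Sum>\<kappa>\<in>v\<Lambda>\<^sup>n. \<delta>\<^bsub>s(\<kappa>)\<^esub>\<close>.\<close>

definition At :: "('a, 'k::finite) kgraph_data \<Rightarrow> nat ^ 'k \<Rightarrow> ('a \<Rightarrow>\<^sub>0 int) \<Rightarrow> ('a \<Rightarrow>\<^sub>0 int)" where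
  "At \<Lambda> n = frag_extend (\<lambda>v. \<Sum>\<kappa> \<in> paths_from_deg \<Lambda> v n. frag_of (sr \<Lambda> \<kappa>))"

lemma lookup_At:
  assumes "row_finite \<Lambda>" and "f \<in> ZV \<Lambda>"
  shows "Poly_Mapping.lookup (At \<Lambda> n f) v =
    (\<Sum>u \<in> Poly_Mapping.keys f. int (coord_matrix \<Lambda> n u v) * Poly_Mapping.lookup f u)"
proof -
  have "(\<Sum>\<kappa> \<in> paths_from_deg \<Lambda> u n. Poly_Mapping.lookup (frag_of (sr \<Lambda> \<kappa>)) v)
      = int (coord_matrix \<Lambda> n u v)" if "u \<in> Poly_Mapping.keys f" for u
  proof -
    have "finite (paths_from_deg \<Lambda> u n)"
      using that assms by (auto simp: row_finite_def ZV_def)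
    then show ?thesis
      by (auto simp: lookup_single when_def coord_matrix_def sum.If_cases intro!: arg_cong[where f = card])
  qed
  then show ?thesis
    by (simp add: At_def frag_extend_def lookup_sum mult.commute)
qed

definition im_one_minus_At :: "('a, 'k::finite) kgraph_data \<Rightarrow> 'k \<Rightarrow> ('a \<Rightarrow>\<^sub>0 int) set" where
  "im_one_minus_At \<Lambda> i = (\<lambda>f. f - At \<Lambda> (axis i 1) f) ` ZV \<Lambda>"

definition sim :: "('a, 'k::finite) kgraph_data \<Rightarrow> ('a \<Rightarrow>\<^sub>0 int) \<Rightarrow> ('a \<Rightarrow>\<^sub>0 int) \<Rightarrow> bool" where
  "sim \<Lambda> x y \<longleftrightarrow> (\<exists>p q. At \<Lambda> p x = At \<Lambda> q y)"

definition approx :: "('a, 'k::finite) kgraph_data \<Rightarrow> ('a \<Rightarrow>\<^sub>0 int) rel" where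
  "approx \<Lambda> = {(f, g). f \<in> NV \<Lambda> \<and> g \<in> NV \<Lambda> \<and>
     (\<exists>(m::nat) x y. (\<forall>i<m. x i \<in> NV \<Lambda> \<and> y i \<in> NV \<Lambda> \<and> sim \<Lambda> (x i) (y i)) \<and>
        sim \<Lambda> f (\<Sum>i<m. x i) \<and> sim \<Lambda> g (\<Sum>i<m. y i))}"

text \<open>Abelian semigroups with identity are written multiplicatively, following \<open>HOL-Algebra\<close>:
  \<open>\<otimes>\<close> stands for \<open>+\<close>, \<open>\<one>\<close> for \<open>0\<close>, and \<open>x [^] n\<close> for \<open>n x\<close>.\<close>

record 'b preordered_monoid = "'b monoid" +
  prec :: "'b \<Rightarrow> 'b \<Rightarrow> bool"  (infix \<open>\<preceq>\<index>\<close> 50)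

definition algebraic_preorder :: "('b, 'm) monoid_scheme \<Rightarrow> 'b \<Rightarrow> 'b \<Rightarrow> bool" where
  "algebraic_preorder S a b \<longleftrightarrow> (\<exists>c \<in> carrier S. a \<otimes>\<^bsub>S\<^esub> c = b)"

definition graph_monoid :: "('a, 'k::finite) kgraph_data \<Rightarrow> ('a \<Rightarrow>\<^sub>0 int) set monoid" where
  "graph_monoid \<Lambda> = \<lparr>carrier = NV \<Lambda> // approx \<Lambda>,
     mult = (\<lambda>X Y. \<Union>f\<in>X. \<Union>g\<in>Y. approx \<Lambda> `` {f + g}),
     one = approx \<Lambda> `` {0}\<rparr>"

definition graph_semigroup ::
    "('a, 'k::finite) kgraph_data \<Rightarrow> ('a \<Rightarrow>\<^sub>0 int) set preordered_monoid" where
  "graph_semigroup \<Lambda> =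
     monoid.extend (graph_monoid \<Lambda>) \<lparr>prec = algebraic_preorder (graph_monoid \<Lambda>)\<rparr>"

lemma graph_semigroup_simps:
  "carrier (graph_semigroup \<Lambda>) = NV \<Lambda> // approx \<Lambda>"
  "\<one>\<^bsub>graph_semigroup \<Lambda>\<^esub> = approx \<Lambda> `` {0}"
  "X \<otimes>\<^bsub>graph_semigroup \<Lambda>\<^esub> Y = (\<Union>f\<in>X. \<Union>g\<in>Y. approx \<Lambda> `` {f + g})"
  "X \<preceq>\<^bsub>graph_semigroup \<Lambda>\<^esub> Y \<longleftrightarrow>
     (\<exists>Z \<in> carrier (graph_semigroup \<Lambda>). X \<otimes>\<^bsub>graph_semigroup \<Lambda>\<^esub> Z = Y)"
  by (simp_all add: graph_semigroup_def monoid.defs graph_monoid_def algebraic_preorder_def)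

definition infinite_element :: "('b, 'm) monoid_scheme \<Rightarrow> 'b \<Rightarrow> bool" where
  "infinite_element S x \<longleftrightarrow> x \<in> carrier S \<and> x \<noteq> \<one>\<^bsub>S\<^esub> \<and>
     (\<exists>y \<in> carrier S. y \<noteq> \<one>\<^bsub>S\<^esub> \<and> x \<otimes>\<^bsub>S\<^esub> y = x)"

definition stably_finite :: "('b, 'm) monoid_scheme \<Rightarrow> bool" where
  "stably_finite S \<longleftrightarrow> (\<nexists>x. infinite_element S x)"

definition is_state :: "('b, 'm) preordered_monoid_scheme \<Rightarrow> ('b \<Rightarrow> ennreal) \<Rightarrow> bool" where
  "is_state S \<phi> \<longleftrightarrow>
     (\<forall>x \<in> carrier S. \<forall>y \<in> carrier S. \<phi> (x \<otimes>\<^bsub>S\<^esub> y) = \<phi> x + \<phi> y) \<and>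
     (\<forall>x \<in> carrier S. \<forall>y \<in> carrier S. x \<preceq>\<^bsub>S\<^esub> y \<longrightarrow> \<phi> x \<le> \<phi> y) \<and>
     \<phi> \<one>\<^bsub>S\<^esub> = 0"

definition nontrivial_state :: "('b, 'm) preordered_monoid_scheme \<Rightarrow> ('b \<Rightarrow> ennreal) \<Rightarrow> bool" where
  "nontrivial_state S \<phi> \<longleftrightarrow> is_state S \<phi> \<and> (\<exists>x \<in> carrier S. \<phi> x \<noteq> 0 \<and> \<phi> x \<noteq> \<infinity>)"

end

(*
  (1) => (4): a nonzero element of the coboundary group in the positive cone, written as
  sum_i (a_i - b_i) - A_i^t (a_i - b_i) with a_i, b_i >= 0, is absorbed by the class of
  sum_i (a_i + b_i), because x and A_i^t x have the same class.
  (4) => (5): modulo the coboundaries, (4) makes the positive cone pointed, and cofinality makes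
  every vertex an order unit.  A maximal extension of the cone among those that omit the negative
  multiples of a vertex is total, and a total cone with an order unit carries a state; its values
  at the vertices are a faithful graph trace.
  (5) => (2) and (5) => (3): a trace extends additively to a strictly positive function on the
  nonzero elements of the semigroup.
  (2) => (1): if x + y = x with x, y nonzero, cofinality gives x <= n y for some n, so
  2 x <= x + n y = x.
  (3) => (5): by cofinality any two nonzero elements bound multiples of each other, so a nontrivial
  state takes values in (0, infinity) on all of them.
*)
theory Submission
  imports Defs
begin

section \<open>States on preordered abelian groups\<close>

text \<open>S(\<Lambda>) need not be cancellative, so equality of classes cannot be tested inside a
  group. Equal classes do agree modulo coboundaries, but an identity modulo coboundaries returns to
  S(\<Lambda>) only after a common summand has been added; this is why (4) is obtained through
  absorption, and hence from stable finiteness. The relation behind S(\<Lambda>) allows a different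
  degree in every shift, so even its transitivity is not formal. It rests on two facts: shifts
  commute, by unique factorization, and \<nat>\<Lambda>\<open>\<^sup>0\<close> has the refinement
  property. The absence of sources keeps the class of 0 trivial, so that being nonzero means the
  same for functions and for classes. The group of functions may have infinite rank, so the trace in
  (5) is produced by order theory and not as an eigenvector. It is normalized at one vertex only,
  and cofinality carries strict positivity from there to every other vertex.\<close>

lemma extend_to_total_cone:
  fixes scale :: "int \<Rightarrow> 'g::ab_group_add \<Rightarrow> 'g"
  assumes "module scale"
    and zero: "0 \<in> K"
    and add: "\<And>f g. f \<in> K \<Longrightarrow> g \<in> K \<Longrightarrow> f + g \<in> K"
    and proper: "\<And>n::nat. 0 < n \<Longrightarrow> - scale (int n) u \<notin> K"
  obtains L where "K \<subseteq> L" "\<And>f g. f \<in> L \<Longrightarrow> g \<in> L \<Longrightarrow> f + g \<in> L"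
    "\<And>n::nat. 0 < n \<Longrightarrow> - scale (int n) u \<notin> L" "\<And>f. f \<in> L \<or> - f \<in> L"
proof -
  interpret module scale by fact
  \<comment> \<open>All negative multiples of \<open>u\<close> are excluded at once, because the
    elimination of \<open>f\<close> below yields a multiple that cannot be prescribed.\<close>
  define \<A> where "\<A> = {L. K \<subseteq> L \<and> (\<forall>f\<in>L. \<forall>g\<in>L. f + g \<in> L) \<and>
    (\<forall>n::nat. 0 < n \<longrightarrow> - scale (int n) u \<notin> L)}"
  have "K \<in> \<A>" using add proper by (auto simp: \<A>_def)
  moreover have "\<Union>\<C> \<in> \<A>" if "\<C> \<noteq> {}" and ch: "subset.chain \<A> \<C>" for \<C>
  proof -
    have sub: "\<C> \<subseteq> \<A>" and tot: "\<And>X Y. X \<in> \<C> \<Longrightarrow> Y \<in> \<C> \<Longrightarrow> X \<subseteq> Y \<or> Y \<subseteq> X"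
      using ch by (auto simp: subset_chain_def)
    have "f + g \<in> \<Union>\<C>" if XY: "X \<in> \<C>" "Y \<in> \<C>" "f \<in> X" "g \<in> Y" for X Y f g
    proof -
      obtain Z where "Z \<in> \<C>" "f \<in> Z" "g \<in> Z" using tot[of X Y] XY by blast
      then show ?thesis using sub by (auto simp: \<A>_def)
    qed
    moreover have "K \<subseteq> \<Union>\<C>" using \<open>\<C> \<noteq> {}\<close> sub unfolding \<A>_def by blast
    moreover have "- scale (int n) u \<notin> \<Union>\<C>" if "0 < n" for n using that sub unfolding \<A>_def by blast
    ultimately show ?thesis unfolding \<A>_def by blast
  qed
  ultimately obtain L where L: "L \<in> \<A>" and max: "\<And>X. X \<in> \<A> \<Longrightarrow> L \<subseteq> X \<Longrightarrow> X = L"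
    using subset_Zorn_nonempty[of \<A>] by blast
  have L_zero: "0 \<in> L" and L_add: "\<And>f g. f \<in> L \<Longrightarrow> g \<in> L \<Longrightarrow> f + g \<in> L"
    and L_proper: "\<And>n::nat. 0 < n \<Longrightarrow> - scale (int n) u \<notin> L"
    using L zero by (auto simp: \<A>_def)
  have L_scale: "scale (int n) f \<in> L" if "f \<in> L" for n f
    by (induction n) (use that in \<open>auto simp: L_zero L_add scale_left_distrib\<close>)
  \<comment> \<open>By maximality, adjoining the nonnegative multiples of a missing \<open>f\<close>
    must create a forbidden element. Its coefficient \<open>j\<close> is positive, as otherwise
    \<open>L\<close> would already contain that element.\<close>
  have absorb: "\<exists>k\<in>L. \<exists>j>0. \<exists>n>0. k + scale (int j) f = - scale (int n) u" if "f \<notin> L" for f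
  proof -
    define L' where "L' = {k + scale (int j) f |k j. k \<in> L}"
    have L'I: "k + scale (int j) f \<in> L'" if "k \<in> L" for k j using that by (auto simp: L'_def)
    have "L \<subseteq> L'" using L'I[of _ 0] by auto
    moreover have "f \<in> L'" using L'I[OF L_zero, of 1] by simp
    ultimately have "L' \<notin> \<A>" using max that by blast
    moreover have "a + b \<in> L'" if ab: "a \<in> L'" "b \<in> L'" for a b
    proof -
      obtain k j k' j' where "a = k + scale (int j) f" "b = k' + scale (int j') f" "k \<in> L" "k' \<in> L"
        using ab by (auto simp: L'_def)
      then have "a + b = (k + k') + scale (int (j + j')) f" "k + k' \<in> L"
        by (auto simp: scale_left_distrib L_add)
      then show ?thesis using L'I by metis
    qed
    ultimately obtain n :: nat where "0 < n" "- scale (int n) u \<in> L'"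
      using \<open>L \<subseteq> L'\<close> L by (auto simp: \<A>_def)
    then obtain k j where kj: "k \<in> L" "k + scale (int j) f = - scale (int n) u"
      by (auto simp: L'_def)
    moreover have "j > 0" using kj L_proper[OF \<open>0 < n\<close>] by (cases j) auto
    ultimately show ?thesis using \<open>0 < n\<close> by blast
  qed
  have "f \<in> L \<or> - f \<in> L" for f
  proof (rule ccontr)
    assume "\<not> (f \<in> L \<or> - f \<in> L)"
    then obtain k j n k' j' n' where *: "k \<in> L" "k' \<in> L" "0 < j" "0 < j'" "0 < n" "0 < n'"
      "k + scale (int j) f = - scale (int n) u" "k' + scale (int j') (- f) = - scale (int n') u"
      using absorb[of f] absorb[of "- f"] by metis
    have k: "k = - scale (int n) u - scale (int j) f" "k' = - scale (int n') u + scale (int j') f"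
      unfolding *(7,8)[symmetric] by simp_all
    \<comment> \<open>The weights \<open>j'\<close> and \<open>j\<close> cancel \<open>f\<close>
      between the two relations.\<close>
    have "scale (int j') k + scale (int j) k' = - scale (int (j' * n + j * n')) u"
      unfolding k by (simp add: algebra_simps)
    moreover have "scale (int j') k + scale (int j) k' \<in> L" by (simp add: L_add L_scale *)
    moreover have "0 < j' * n + j * n'" using * by simp
    ultimately show False using L_proper by metis
  qed
  then show ?thesis using that[of L] L L_add L_proper by (auto simp: \<A>_def)
qed

text \<open>The value at \<open>f\<close> is the infimum of all m / n with n f \<le> m u in the
  order of a total cone. Upper bounds add up, which gives subadditivity; totality of the cone
  supplies the reverse inequality.\<close>

lemma exists_state:
  fixes scale :: "int \<Rightarrow> 'g::ab_group_add \<Rightarrow> 'g"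
  assumes "module scale"
    and zero: "0 \<in> K"
    and add: "\<And>f g. f \<in> K \<Longrightarrow> g \<in> K \<Longrightarrow> f + g \<in> K"
    and proper: "\<And>n::nat. 0 < n \<Longrightarrow> - scale (int n) u \<notin> K"
    and order_unit: "\<And>f. \<exists>m. scale m u - f \<in> K"
  obtains \<phi> :: "'g \<Rightarrow> real"
    where "Modules.additive \<phi>" "\<And>f. f \<in> K \<Longrightarrow> 0 \<le> \<phi> f" "\<phi> u = 1"
proof -
  interpret module scale by fact
  obtain L where L: "K \<subseteq> L" "\<And>f g. f \<in> L \<Longrightarrow> g \<in> L \<Longrightarrow> f + g \<in> L"
    "\<And>n::nat. 0 < n \<Longrightarrow> - scale (int n) u \<notin> L" "\<And>f. f \<in> L \<or> - f \<in> L"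
    using extend_to_total_cone[OF \<open>module scale\<close> zero add proper] by blast
  have L_zero: "0 \<in> L" using L(1) zero by blast
  have L_scale: "scale (int n) f \<in> L" if "f \<in> L" for n f
    by (induction n) (use that in \<open>auto simp: L_zero L(2) scale_left_distrib\<close>)
  have pos: "0 \<le> m" if "scale m u \<in> L" for m
  proof (rule ccontr)
    assume "\<not> 0 \<le> m"
    then show False using L(3)[of "nat (- m)"] that by simp
  qed
  \<comment> \<open>Since \<open>u\<close> cannot be divided by \<open>n\<close>, the inequality f
    \<le> (m / n) u is stated after clearing the denominator.\<close>
  define D where "D f = {real_of_int m / real n |m (n::nat). 0 < n \<and> scale m u - scale (int n) f \<in> L}"
    for f :: 'g
  define \<phi> :: "'g \<Rightarrow> real" where "\<phi> f = Inf (D f)" for f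
  have DI: "of_int m / of_nat n \<in> D f" if "0 < n" "scale m u - scale (int n) f \<in> L" for m n f
    using that unfolding D_def by blast
  have D_int: "of_int m \<in> D f" if "scale m u - f \<in> L" for m f
    using DI[of 1 m f] that by simp
  have ne: "D f \<noteq> {}" for f
    using order_unit[of f] L(1) D_int by blast
  have bdd: "bdd_below (D f)" for f
  proof -
    obtain c where c: "scale c u - (- f) \<in> L" using order_unit[of "- f"] L(1) by blast
    have "- of_int c \<le> q" if qD: "q \<in> D f" for q
    proof -
      obtain m n where q: "q = of_int m / of_nat n" "0 < n" "scale m u - scale (int n) f \<in> L"
        using qD by (auto simp: D_def)
      \<comment> \<open>Adding \<open>n\<close> copies of -f \<le> c u to n f \<le> m u cancels
        \<open>f\<close> and leaves a multiple of \<open>u\<close>, whose coefficient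
        \<open>pos\<close> controls.\<close>
      have "(scale m u - scale (int n) f) + scale (int n) (scale c u - (- f)) \<in> L"
        using q c by (intro L(2) L_scale)
      then have "scale (m + int n * c) u \<in> L" by (simp add: algebra_simps)
      then have "0 \<le> m + int n * c" by (rule pos)
      then have "0 \<le> real_of_int (m + int n * c)" by (simp only: of_int_0_le_iff)
      then have "0 \<le> (q + of_int c) * real n" using q(1,2) by (simp add: algebra_simps)
      then show ?thesis using q(2) by (simp add: zero_le_mult_iff)
    qed
    then show ?thesis by (auto simp: bdd_below_def)
  qed
  have subadd: "\<phi> (f + g) \<le> \<phi> f + \<phi> g" for f g
  proof -
    have D_add: "a + b \<in> D (f + g)" if "a \<in> D f" "b \<in> D g" for a b
    proof -
      obtain m n where a: "a = of_int m / of_nat n" "0 < n" "scale m u - scale (int n) f \<in> L"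
        using \<open>a \<in> D f\<close> by (auto simp: D_def)
      obtain m' n' where b: "b = of_int m' / of_nat n'" "0 < n'" "scale m' u - scale (int n') g \<in> L"
        using \<open>b \<in> D g\<close> by (auto simp: D_def)
      have "scale (int n') (scale m u - scale (int n) f) + scale (int n) (scale m' u - scale (int n') g) \<in> L"
        using a b by (intro L(2) L_scale)
      then have "scale (int n' * m + int n * m') u - scale (int (n * n')) (f + g) \<in> L"
        by (simp add: algebra_simps)
      moreover have "a + b = of_int (int n' * m + int n * m') / of_nat (n * n')"
        using a b by (simp add: field_simps)
      ultimately show ?thesis using a(2) b(2) DI[of "n * n'" "int n' * m + int n * m'" "f + g"] by simp
    qed
    \<comment> \<open>The two infima are taken one after the other: \<open>b\<close> stays fixed
      while the bounds of \<open>f\<close> vary.\<close>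
    have "\<phi> (f + g) - b \<le> \<phi> f" if "b \<in> D g" for b
      unfolding \<phi>_def[of f] by (intro cInf_greatest[OF ne])
        (use D_add that in \<open>auto simp: \<phi>_def algebra_simps intro!: cInf_lower bdd\<close>)
    then have "\<phi> (f + g) - \<phi> f \<le> \<phi> g"
      unfolding \<phi>_def[of g] by (intro cInf_greatest[OF ne]) (auto simp: algebra_simps)
    then show ?thesis by simp
  qed
  have \<phi>_zero: "\<phi> 0 = 0"
  proof (rule antisym)
    have "0 \<in> D 0" using L_zero D_int[of 0 0] by simp
    then show "\<phi> 0 \<le> 0" unfolding \<phi>_def by (intro cInf_lower bdd)
    show "0 \<le> \<phi> 0" unfolding \<phi>_def by (intro cInf_greatest[OF ne]) (auto simp: D_def dest: pos)
  qed
  have \<phi>_unit: "\<phi> u = 1"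
  proof (rule antisym)
    have "1 \<in> D u" using L_zero D_int[of 1 u] by simp
    then show "\<phi> u \<le> 1" unfolding \<phi>_def by (intro cInf_lower bdd)
    have "1 \<le> q" if "q \<in> D u" for q
    proof -
      obtain m n where q: "q = of_int m / of_nat n" "0 < n" "scale m u - scale (int n) u \<in> L"
        using \<open>q \<in> D u\<close> by (auto simp: D_def)
      then have "int n \<le> m" using pos[of "m - int n"] by (simp add: scale_left_diff_distrib)
      then have "real n \<le> of_int m" by linarith
      then show ?thesis using q by simp
    qed
    then show "1 \<le> \<phi> u" unfolding \<phi>_def by (intro cInf_greatest[OF ne])
  qed
  \<comment> \<open>A rational strictly between \<open>- \<phi> (- f)\<close> and \<open>\<phi> f\<close> would contradict totality of \<open>L\<close>.\<close>
  have minus_le: "\<phi> (- f) \<le> - \<phi> f" for f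
  proof (rule ccontr)
    assume "\<not> \<phi> (- f) \<le> - \<phi> f"
    then have "- \<phi> (- f) < \<phi> f" by simp
    then obtain q where q: "q \<in> \<rat>" "- \<phi> (- f) < q" "q < \<phi> f" using Rats_dense_in_real by blast
    obtain m b where mb: "0 < b" "q = of_int m / of_int b" using q(1) by (elim Rats_cases') auto
    define n where "n = nat b"
    have mn: "0 < n" "q = of_int m / of_nat n" using mb by (auto simp: n_def)
    have "q \<notin> D f" using q(3) cInf_lower[OF _ bdd, of q f] by (auto simp: \<phi>_def)
    then have "scale m u - scale (int n) f \<notin> L" using mn by (auto simp: D_def)
    then have "- (scale m u - scale (int n) f) \<in> L" using L(4) by blast
    then have "scale (- m) u - scale (int n) (- f) \<in> L" by simp
    then have "- q \<in> D (- f)" using mn DI[of n "- m" "- f"] by simp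
    then have "\<phi> (- f) \<le> - q" unfolding \<phi>_def by (intro cInf_lower bdd)
    then show False using q by simp
  qed
  have minus: "\<phi> (- f) = - \<phi> f" for f
    using minus_le[of f] subadd[of f "- f"] \<phi>_zero by simp
  have "Modules.additive \<phi>"
  proof
    fix f g
    have "\<phi> f \<le> \<phi> (f + g) - \<phi> g" using subadd[of "f + g" "- g"] by (simp add: minus)
    then show "\<phi> (f + g) = \<phi> f + \<phi> g" using subadd[of f g] by simp
  qed
  moreover have "0 \<le> \<phi> f" if "f \<in> K" for f
  proof -
    have "0 \<in> D (- f)" using that L(1) D_int[of 0 "- f"] by auto
    then have "\<phi> (- f) \<le> 0" unfolding \<phi>_def by (intro cInf_lower bdd)
    then show ?thesis by (simp add: minus)
  qed
  ultimately show ?thesis using that \<phi>_unit by blast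
qed

lemma module_frag_cmul: "module frag_cmul"
  by unfold_locales (auto simp: frag_cmul_distrib frag_cmul_distrib2)

section \<open>The action of degrees on finitely supported functions\<close>

text \<open>The coordinate sum is the measure. Coboundaries are generated by the degrees
  \<open>axis i 1\<close> alone, while shifts occur in every degree; this induction bridges the
  gap.\<close>

lemma nat_vec_induct [case_names zero step]:
  fixes n :: "nat ^ 'k::finite"
  assumes "P 0" and step: "\<And>n i. P n \<Longrightarrow> P (n + axis i 1)"
  shows "P n"
proof (induction "\<Sum>i\<in>UNIV. n $ i" arbitrary: n)
  case 0
  then have "n = 0" by (auto simp: vec_eq_iff)
  then show ?case using \<open>P 0\<close> by simp
next
  case (Suc m)
  then obtain i where i: "n $ i \<noteq> 0" by (metis nat.distinct(1) sum.neutral)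
  define n' where "n' = (\<chi> j. n $ j - (if j = i then 1 else 0))"
  have n: "n = n' + axis i 1" using i by (auto simp: n'_def vec_eq_iff axis_def)
  have "(\<Sum>j\<in>UNIV. n $ j) = (\<Sum>j\<in>UNIV. n' $ j) + (\<Sum>j\<in>UNIV. axis i 1 $ j)"
    by (subst n) (simp add: sum.distrib)
  then have "m = (\<Sum>j\<in>UNIV. n' $ j)" using Suc(2) by (simp add: axis_def)
  then show ?case using Suc(1) step n by metis
qed

locale sourceless_kgraph = kgraph +
  assumes row_finite: "row_finite \<Lambda>" and no_sources: "no_sources \<Lambda>"
begin

section \<open>Vertices, paths of a fixed degree and unique factorization\<close>

lemma rg_vertex: "v \<in> vertices \<Lambda> \<Longrightarrow> rg \<Lambda> v = v"
  unfolding vertices_eq_identities using rg_sr sr_rg rg_closed by (metis (no_types, lifting) imageE)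

lemma sr_vertex: "v \<in> vertices \<Lambda> \<Longrightarrow> sr \<Lambda> v = v"
  unfolding vertices_eq_identities using sr_rg by auto

lemma rg_in_vertices: "\<kappa> \<in> paths \<Lambda> \<Longrightarrow> rg \<Lambda> \<kappa> \<in> vertices \<Lambda>"
  unfolding vertices_eq_identities by auto

lemma sr_in_vertices: "\<kappa> \<in> paths \<Lambda> \<Longrightarrow> sr \<Lambda> \<kappa> \<in> vertices \<Lambda>"
  using rg_in_vertices[OF sr_closed] rg_sr by metis

lemma paths_from_degD:
  assumes "\<kappa> \<in> paths_from_deg \<Lambda> v n"
  shows "\<kappa> \<in> paths \<Lambda>" "rg \<Lambda> \<kappa> = v" "deg \<Lambda> \<kappa> = n" "sr \<Lambda> \<kappa> \<in> vertices \<Lambda>"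
  using assms sr_in_vertices by (auto simp: paths_from_deg_def paths_from_def paths_deg_def)

lemma paths_from_degI: "\<kappa> \<in> paths \<Lambda> \<Longrightarrow> \<kappa> \<in> paths_from_deg \<Lambda> (rg \<Lambda> \<kappa>) (deg \<Lambda> \<kappa>)"
  by (auto simp: paths_from_deg_def paths_from_def paths_deg_def)

text \<open>Makes finiteness of \<open>paths_from_deg\<close> unconditional, so that later sums over
  it carry no side condition on \<open>v\<close>.\<close>

lemma paths_from_deg_not_vertex: "v \<notin> vertices \<Lambda> \<Longrightarrow> paths_from_deg \<Lambda> v n = {}"
  using paths_from_degD(1,2) rg_in_vertices by blast

lemma finite_paths_from_deg: "finite (paths_from_deg \<Lambda> v n)"
  using row_finite paths_from_deg_not_vertex[of v n] by (cases "v \<in> vertices \<Lambda>") (auto simp: row_finite_def)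

lemma paths_from_deg_zero:
  assumes "v \<in> vertices \<Lambda>"
  shows "paths_from_deg \<Lambda> v 0 = {v}"
  using assms rg_vertex by (auto simp: paths_from_deg_def paths_from_def paths_deg_def)

lemma factorization_unique:
  assumes "\<mu> \<in> paths \<Lambda>" "\<nu> \<in> paths \<Lambda>" "sr \<Lambda> \<mu> = rg \<Lambda> \<nu>"
    and "\<mu>' \<in> paths \<Lambda>" "\<nu>' \<in> paths \<Lambda>" "sr \<Lambda> \<mu>' = rg \<Lambda> \<nu>'"
    and "deg \<Lambda> \<mu> = deg \<Lambda> \<mu>'" "deg \<Lambda> \<nu> = deg \<Lambda> \<nu>'" "\<mu> \<cdot> \<nu> = \<mu>' \<cdot> \<nu>'"
  shows "\<mu> = \<mu>' \<and> \<nu> = \<nu>'"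
proof -
  let ?P = "\<lambda>(\<alpha>, \<beta>). \<alpha> \<in> paths \<Lambda> \<and> \<beta> \<in> paths \<Lambda> \<and> sr \<Lambda> \<alpha> = rg \<Lambda> \<beta> \<and>
    deg \<Lambda> \<alpha> = deg \<Lambda> \<mu> \<and> deg \<Lambda> \<beta> = deg \<Lambda> \<nu> \<and> \<mu> \<cdot> \<nu> = \<alpha> \<cdot> \<beta>"
  have "\<exists>!p. ?P p" using unique_factorization[OF cmp_closed deg_cmp] assms(1-3) by blast
  moreover have "?P (\<mu>, \<nu>)" "?P (\<mu>', \<nu>')" using assms by simp_all
  ultimately have "(\<mu>, \<nu>) = (\<mu>', \<nu>')" by (elim ex1E) (blast intro: trans sym)
  then show ?thesis by simp
qed

text \<open>Unique factorization in the form that counts paths; it is the source of the action law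
  \<open>At_At\<close>.\<close>

lemma bij_betw_cmp:
  "bij_betw (\<lambda>(\<mu>, \<nu>). \<mu> \<cdot> \<nu>)
    (Sigma (paths_from_deg \<Lambda> v m) (\<lambda>\<mu>. paths_from_deg \<Lambda> (sr \<Lambda> \<mu>) n)) (paths_from_deg \<Lambda> v (m + n))"
proof -
  let ?D = "Sigma (paths_from_deg \<Lambda> v m) (\<lambda>\<mu>. paths_from_deg \<Lambda> (sr \<Lambda> \<mu>) n)"
  have dom: "\<mu> \<in> paths \<Lambda>" "\<nu> \<in> paths \<Lambda>" "sr \<Lambda> \<mu> = rg \<Lambda> \<nu>" "deg \<Lambda> \<mu> = m" "deg \<Lambda> \<nu> = n" "rg \<Lambda> \<mu> = v"
    if "(\<mu>, \<nu>) \<in> ?D" for \<mu> \<nu>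
    using that paths_from_degD by auto
  have cod: "\<mu> \<cdot> \<nu> \<in> paths_from_deg \<Lambda> v (m + n)" if "(\<mu>, \<nu>) \<in> ?D" for \<mu> \<nu>
    using dom[OF that] paths_from_degI[OF cmp_closed, of \<mu> \<nu>] by (simp add: rg_cmp deg_cmp)
  have "inj_on (\<lambda>(\<mu>, \<nu>). \<mu> \<cdot> \<nu>) ?D"
  proof (rule inj_onI, clarify)
    fix \<mu> \<nu> \<mu>' \<nu>'
    assume "\<mu> \<in> paths_from_deg \<Lambda> v m" "\<nu> \<in> paths_from_deg \<Lambda> (sr \<Lambda> \<mu>) n"
      "\<mu>' \<in> paths_from_deg \<Lambda> v m" "\<nu>' \<in> paths_from_deg \<Lambda> (sr \<Lambda> \<mu>') n"
      and eq: "\<mu> \<cdot> \<nu> = \<mu>' \<cdot> \<nu>'"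
    then have D: "(\<mu>, \<nu>) \<in> ?D" "(\<mu>', \<nu>') \<in> ?D" by auto
    show "\<mu> = \<mu>' \<and> \<nu> = \<nu>'"
      by (rule factorization_unique) (use dom[OF D(1)] dom[OF D(2)] eq in simp_all)
  qed
  moreover have "\<kappa> \<in> (\<lambda>(\<mu>, \<nu>). \<mu> \<cdot> \<nu>) ` ?D" if k: "\<kappa> \<in> paths_from_deg \<Lambda> v (m + n)" for \<kappa>
  proof -
    obtain \<mu> \<nu> where *: "\<mu> \<in> paths \<Lambda>" "\<nu> \<in> paths \<Lambda>" "sr \<Lambda> \<mu> = rg \<Lambda> \<nu>" "deg \<Lambda> \<mu> = m" "deg \<Lambda> \<nu> = n"
      "\<kappa> = \<mu> \<cdot> \<nu>"
      using ex1_implies_ex[OF unique_factorization[of \<kappa> m n]] paths_from_degD[OF k] by auto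
    then have "(\<mu>, \<nu>) \<in> ?D"
      using paths_from_degI[of \<mu>] paths_from_degI[of \<nu>] paths_from_degD(2)[OF k] rg_cmp[of \<mu> \<nu>] by auto
    then show ?thesis using * by force
  qed
  ultimately show ?thesis using cod by (auto simp: bij_betw_def)
qed

lemma sum_paths_from_deg_add:
  "(\<Sum>\<kappa>\<in>paths_from_deg \<Lambda> v (m + n). g (sr \<Lambda> \<kappa>)) =
   (\<Sum>\<mu>\<in>paths_from_deg \<Lambda> v m. \<Sum>\<nu>\<in>paths_from_deg \<Lambda> (sr \<Lambda> \<mu>) n. g (sr \<Lambda> \<nu>))"
proof -
  have "(\<Sum>\<mu>\<in>paths_from_deg \<Lambda> v m. \<Sum>\<nu>\<in>paths_from_deg \<Lambda> (sr \<Lambda> \<mu>) n. g (sr \<Lambda> \<nu>)) =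
    (\<Sum>(\<mu>, \<nu>)\<in>Sigma (paths_from_deg \<Lambda> v m) (\<lambda>\<mu>. paths_from_deg \<Lambda> (sr \<Lambda> \<mu>) n). g (sr \<Lambda> \<nu>))"
    by (simp add: sum.Sigma finite_paths_from_deg)
  also have "\<dots> = (\<Sum>x\<in>Sigma (paths_from_deg \<Lambda> v m) (\<lambda>\<mu>. paths_from_deg \<Lambda> (sr \<Lambda> \<mu>) n).
      g (sr \<Lambda> (case x of (\<mu>, \<nu>) \<Rightarrow> \<mu> \<cdot> \<nu>)))"
    by (intro sum.cong) (auto simp: paths_from_degD sr_cmp)
  also have "\<dots> = (\<Sum>\<kappa>\<in>paths_from_deg \<Lambda> v (m + n). g (sr \<Lambda> \<kappa>))"
    by (rule sum.reindex_bij_betw[OF bij_betw_cmp])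
  finally show ?thesis by simp
qed

section \<open>The positive cone and its refinement property\<close>

lemma ZV_zero [simp]: "0 \<in> ZV \<Lambda>"
  and ZV_add: "f \<in> ZV \<Lambda> \<Longrightarrow> g \<in> ZV \<Lambda> \<Longrightarrow> f + g \<in> ZV \<Lambda>"
  and ZV_diff: "f \<in> ZV \<Lambda> \<Longrightarrow> g \<in> ZV \<Lambda> \<Longrightarrow> f - g \<in> ZV \<Lambda>"
  and ZV_uminus: "f \<in> ZV \<Lambda> \<Longrightarrow> - f \<in> ZV \<Lambda>"
  using Poly_Mapping.keys_add[of f g] keys_diff[of f g] by (auto simp: ZV_def)

lemma NV_ZV: "f \<in> NV \<Lambda> \<Longrightarrow> f \<in> ZV \<Lambda>"
  by (simp add: NV_def)

lemma NV_zero [simp]: "0 \<in> NV \<Lambda>"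
  and NV_add [simp]: "f \<in> NV \<Lambda> \<Longrightarrow> g \<in> NV \<Lambda> \<Longrightarrow> f + g \<in> NV \<Lambda>"
  and NV_frag_of: "v \<in> vertices \<Lambda> \<Longrightarrow> frag_of v \<in> NV \<Lambda>"
  by (auto simp: NV_def lookup_add ZV_add) (auto simp: ZV_def)

lemma NV_sum: "(\<And>i. i \<in> I \<Longrightarrow> x i \<in> NV \<Lambda>) \<Longrightarrow> sum x I \<in> NV \<Lambda>"
  by (induction I rule: infinite_finite_induct) auto

lemma NV_cmul: "f \<in> NV \<Lambda> \<Longrightarrow> frag_cmul (int n) f \<in> NV \<Lambda>"
  by (auto simp: NV_def ZV_def)

lemma NV_antisym: "f \<in> NV \<Lambda> \<Longrightarrow> g \<in> NV \<Lambda> \<Longrightarrow> f + g = 0 \<Longrightarrow> f = 0"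
  by (auto simp: NV_def poly_mapping_eq_iff lookup_add fun_eq_iff add_nonneg_eq_0_iff)

lemma NV_cases:
  assumes "f \<in> NV \<Lambda>" "f \<noteq> 0"
  obtains v g where "v \<in> vertices \<Lambda>" "g \<in> NV \<Lambda>" "f = g + frag_of v"
proof -
  obtain v where v: "v \<in> Poly_Mapping.keys f" using assms(2) keys_eq_empty by blast
  then have "v \<in> vertices \<Lambda>" using assms by (auto simp: NV_def ZV_def)
  moreover have "f - frag_of v \<in> NV \<Lambda>"
    using assms v calculation ZV_diff[OF NV_ZV NV_ZV[OF NV_frag_of]]
    by (auto simp: NV_def lookup_minus in_keys_iff) (metis dual_order.antisym not_less zle_diff1_eq diff_0 diff_ge_0_iff_ge int_one_le_iff_zero_less)
  ultimately show ?thesis using that[of v "f - frag_of v"] by simp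
qed

lemma NV_induct [consumes 1, case_names zero add]:
  assumes "f \<in> NV \<Lambda>" and "P 0"
    and "\<And>f v. f \<in> NV \<Lambda> \<Longrightarrow> v \<in> vertices \<Lambda> \<Longrightarrow> P f \<Longrightarrow> P (f + frag_of v)"
  shows "P f"
proof -
  \<comment> \<open>The total mass of \<open>f\<close>, which drops strictly when a vertex is
    removed.\<close>
  define c where "c f = (\<Sum>v\<in>Poly_Mapping.keys f. nat (Poly_Mapping.lookup f v))" for f :: "'a \<Rightarrow>\<^sub>0 int"
  show ?thesis using assms(1)
  proof (induction "c f" arbitrary: f rule: less_induct)
    case less
    show ?case
    proof (cases "f = 0")
      case True
      then show ?thesis using \<open>P 0\<close> by simp
    next
      case False
      then obtain v g where g: "v \<in> vertices \<Lambda>" "g \<in> NV \<Lambda>" "f = g + frag_of v"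
        using NV_cases less(2) by metis
      have keys: "Poly_Mapping.keys g \<subseteq> Poly_Mapping.keys f" "v \<in> Poly_Mapping.keys f"
        using g by (auto simp: in_keys_iff lookup_add NV_def add_nonneg_eq_0_iff)
      have "c g = (\<Sum>w\<in>Poly_Mapping.keys f. nat (Poly_Mapping.lookup g w))"
        unfolding c_def by (rule sum.mono_neutral_left) (use keys in \<open>auto simp: in_keys_iff\<close>)
      also have "\<dots> < c f"
        unfolding c_def by (rule sum_strict_mono_ex1)
          (use g keys in \<open>auto simp: lookup_add NV_def intro!: bexI[of _ v]\<close>)
      finally show ?thesis using less(1) g assms(3) by auto
    qed
  qed
qed

text \<open>Riesz refinement: take for \<open>p\<close> the pointwise minimum of \<open>a\<close>
  and \<open>c\<close>; the other three pieces are then forced. Transitivity of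
  \<open>approx\<close> depends on it.\<close>

lemma NV_refinement:
  assumes NV: "a \<in> NV \<Lambda>" "b \<in> NV \<Lambda>" "c \<in> NV \<Lambda>" "d \<in> NV \<Lambda>" and eq: "a + b = c + d"
  obtains p q r s where "p \<in> NV \<Lambda>" "q \<in> NV \<Lambda>" "r \<in> NV \<Lambda>" "s \<in> NV \<Lambda>"
    "a = p + q" "b = r + s" "c = p + r" "d = q + s"
proof -
  define p where "p = Abs_poly_mapping (\<lambda>v. min (Poly_Mapping.lookup a v) (Poly_Mapping.lookup c v))"
  have fin: "finite {v. min (Poly_Mapping.lookup a v) (Poly_Mapping.lookup c v) \<noteq> 0}"
    by (rule finite_subset[of _ "Poly_Mapping.keys a \<union> Poly_Mapping.keys c"]) (auto simp: in_keys_iff min_def)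
  have p: "Poly_Mapping.lookup p v = min (Poly_Mapping.lookup a v) (Poly_Mapping.lookup c v)" for v
    unfolding p_def using fin by simp
  have "Poly_Mapping.keys p \<subseteq> Poly_Mapping.keys a \<union> Poly_Mapping.keys c"
    by (auto simp: in_keys_iff p min_def split: if_splits)
  then have pZ: "p \<in> ZV \<Lambda>" using NV(1,3) by (auto simp: NV_def ZV_def)
  have d: "d = a + b - c" using eq by (simp add: algebra_simps)
  have lk: "Poly_Mapping.lookup a v + Poly_Mapping.lookup b v \<ge> Poly_Mapping.lookup c v" for v
    using NV(4) unfolding d NV_def by (simp add: lookup_add lookup_minus)
  have nn: "0 \<le> Poly_Mapping.lookup a v" "0 \<le> Poly_Mapping.lookup b v" "0 \<le> Poly_Mapping.lookup c v" for v
    using NV by (auto simp: NV_def)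
  have "p \<in> NV \<Lambda>" "a - p \<in> NV \<Lambda>" "c - p \<in> NV \<Lambda>"
    using pZ NV nn by (auto simp: NV_def p lookup_minus ZV_diff)
  \<comment> \<open>Where the minimum is \<open>c\<close> this entry is that of \<open>b\<close>,
    and where it is \<open>a\<close> it is that of \<open>d\<close>.\<close>
  moreover have "b - (c - p) \<in> NV \<Lambda>"
    using pZ NV nn(2) lk unfolding NV_def
    by (auto simp: p lookup_minus ZV_diff min_def) (smt (verit))
  ultimately show ?thesis using that[of p "a - p" "c - p" "b - (c - p)"] by (simp add: d algebra_simps)
qed

section \<open>Degrees acting by commuting positive operators\<close>

lemma At_add: "At \<Lambda> n (f + g) = At \<Lambda> n f + At \<Lambda> n g"
  and At_diff: "At \<Lambda> n (f - g) = At \<Lambda> n f - At \<Lambda> n g"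
  and At_0 [simp]: "At \<Lambda> n 0 = 0"
  and At_frag_of: "At \<Lambda> n (frag_of v) = (\<Sum>\<kappa>\<in>paths_from_deg \<Lambda> v n. frag_of (sr \<Lambda> \<kappa>))"
  by (simp_all add: At_def frag_extend_add frag_extend_diff)

lemma At_sum: "At \<Lambda> n (sum f I) = (\<Sum>i\<in>I. At \<Lambda> n (f i))"
  by (induction I rule: infinite_finite_induct) (auto simp: At_add)

lemma At_NV [simp]: "f \<in> NV \<Lambda> \<Longrightarrow> At \<Lambda> n f \<in> NV \<Lambda>"
  by (induction rule: NV_induct)
    (auto simp: At_add At_frag_of intro!: NV_add NV_sum NV_frag_of dest: paths_from_degD)

lemma ZV_induct [consumes 1, case_names zero one diff]:
  assumes "f \<in> ZV \<Lambda>" "P 0" "\<And>v. v \<in> vertices \<Lambda> \<Longrightarrow> P (frag_of v)"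
    "\<And>f g. P f \<Longrightarrow> P g \<Longrightarrow> P (f - g)"
  shows "P f"
  using assms frag_induction[of f "vertices \<Lambda>" P] by (auto simp: ZV_def)

lemma ZV_decompose:
  assumes "f \<in> ZV \<Lambda>"
  shows "\<exists>a b. a \<in> NV \<Lambda> \<and> b \<in> NV \<Lambda> \<and> f = a - b"
  using assms
proof (induction rule: ZV_induct)
  case zero
  then show ?case by (intro exI[of _ 0]) simp
next
  case (one v)
  then show ?case by (intro exI[of _ "frag_of v"] exI[of _ 0]) (simp add: NV_frag_of)
next
  case (diff f g)
  then obtain a b c d where *: "a \<in> NV \<Lambda>" "b \<in> NV \<Lambda>" "c \<in> NV \<Lambda>" "d \<in> NV \<Lambda>" "f = a - b" "g = c - d"
    by blast
  then show ?case by (intro exI[of _ "a + d"] exI[of _ "b + c"]) simp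
qed

lemma At_ZV: "f \<in> ZV \<Lambda> \<Longrightarrow> At \<Lambda> n f \<in> ZV \<Lambda>"
  by (induction rule: ZV_induct) (auto simp: At_diff NV_frag_of intro: ZV_diff NV_ZV[OF At_NV])

text \<open>On a vertex this is the count of composable pairs. Since addition of degrees is
  commutative, all shifts commute, and the later degree bookkeeping uses nothing else.\<close>

lemma At_At: "At \<Lambda> n (At \<Lambda> m f) = At \<Lambda> (m + n) f" if "f \<in> ZV \<Lambda>"
  using that by (induction rule: ZV_induct)
    (auto simp: At_diff At_frag_of At_sum sum_paths_from_deg_add[where g = frag_of])

text \<open>The restriction to \<open>ZV\<close> matters: a generator that is not a vertex is sent
  to 0 by every shift.\<close>

lemma At_zero_deg: "f \<in> ZV \<Lambda> \<Longrightarrow> At \<Lambda> 0 f = f"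
  by (induction rule: ZV_induct) (auto simp: At_diff At_frag_of paths_from_deg_zero sr_vertex)

lemma At_frag_of_cases:
  assumes "\<kappa> \<in> paths_from_deg \<Lambda> v n"
  obtains g where "g \<in> NV \<Lambda>" "At \<Lambda> n (frag_of v) = g + frag_of (sr \<Lambda> \<kappa>)"
proof
  show "At \<Lambda> n (frag_of v) = (\<Sum>\<nu>\<in>paths_from_deg \<Lambda> v n - {\<kappa>}. frag_of (sr \<Lambda> \<nu>)) + frag_of (sr \<Lambda> \<kappa>)"
    using assms by (simp add: At_frag_of sum.remove finite_paths_from_deg add.commute)
qed (auto intro!: NV_sum NV_frag_of dest: paths_from_degD)

lemma frag_of_add_nonzero: "g \<in> NV \<Lambda> \<Longrightarrow> v \<in> vertices \<Lambda> \<Longrightarrow> g + frag_of v \<noteq> 0"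
  using NV_antisym[of "frag_of v" g] NV_frag_of by (auto simp: add.commute)

text \<open>Without sources, a vertex in the support of \<open>f\<close> contributes the source of
  some path of degree \<open>n\<close>, and nonnegative entries cannot cancel it.\<close>

lemma At_eq_0_iff:
  assumes "f \<in> NV \<Lambda>"
  shows "At \<Lambda> n f = 0 \<longleftrightarrow> f = 0"
proof
  assume 0: "At \<Lambda> n f = 0"
  show "f = 0"
  proof (rule ccontr)
    assume "f \<noteq> 0"
    then obtain v g where g: "v \<in> vertices \<Lambda>" "g \<in> NV \<Lambda>" "f = g + frag_of v"
      using NV_cases assms by metis
    obtain \<kappa> where k: "\<kappa> \<in> paths_from_deg \<Lambda> v n" using no_sources g(1) by (auto simp: no_sources_def)
    obtain h where "h \<in> NV \<Lambda>" "At \<Lambda> n (frag_of v) = h + frag_of (sr \<Lambda> \<kappa>)"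
      using At_frag_of_cases[OF k] .
    then have "At \<Lambda> n f = (At \<Lambda> n g + h) + frag_of (sr \<Lambda> \<kappa>)" by (simp add: g At_add add.assoc)
    then show False
      using 0 frag_of_add_nonzero[of "At \<Lambda> n g + h" "sr \<Lambda> \<kappa>"] g \<open>h \<in> NV \<Lambda>\<close> paths_from_degD(4)[OF k] by simp
  qed
qed simp

end

section \<open>The semigroup of a higher-rank graph\<close>

text \<open>The relation \<open>approx\<close> before the outer shifts by degrees.  It absorbs independent shifts on
  both sides, which keeps the bookkeeping of degrees in the proof of transitivity light.\<close>

inductive sum_sim :: "('a, 'k::finite) kgraph_data \<Rightarrow> ('a \<Rightarrow>\<^sub>0 int) \<Rightarrow> ('a \<Rightarrow>\<^sub>0 int) \<Rightarrow> bool"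
  for \<Lambda> where
  zero: "sum_sim \<Lambda> 0 0"
| add: "\<lbrakk>sum_sim \<Lambda> a b; x \<in> NV \<Lambda>; y \<in> NV \<Lambda>; sim \<Lambda> x y\<rbrakk> \<Longrightarrow> sum_sim \<Lambda> (a + x) (b + y)"

lemma sum_sim_sum:
  "(\<And>i. i < m \<Longrightarrow> x i \<in> NV \<Lambda> \<and> y i \<in> NV \<Lambda> \<and> sim \<Lambda> (x i) (y i))
    \<Longrightarrow> sum_sim \<Lambda> (\<Sum>i<m. x i) (\<Sum>i<m. y i)" for m :: nat
  by (induction m) (auto intro: sum_sim.intros)

lemma sum_sim_obtain:
  assumes "sum_sim \<Lambda> a b"
  obtains m :: nat and x y where "\<And>i. i < m \<Longrightarrow> x i \<in> NV \<Lambda> \<and> y i \<in> NV \<Lambda> \<and> sim \<Lambda> (x i) (y i)"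
    "a = (\<Sum>i<m. x i)" "b = (\<Sum>i<m. y i)"
proof -
  have "\<exists>(m::nat) x y. (\<forall>i<m. x i \<in> NV \<Lambda> \<and> y i \<in> NV \<Lambda> \<and> sim \<Lambda> (x i) (y i)) \<and>
      a = (\<Sum>i<m. x i) \<and> b = (\<Sum>i<m. y i)"
    using assms
  proof induction
    case zero
    show ?case by (rule exI[of _ 0]) auto
  next
    case (add a b x' y')
    then obtain m :: nat and x y where "\<forall>i<m. x i \<in> NV \<Lambda> \<and> y i \<in> NV \<Lambda> \<and> sim \<Lambda> (x i) (y i)"
      "a = (\<Sum>i<m. x i)" "b = (\<Sum>i<m. y i)" by blast
    then show ?case using add
      by (intro exI[of _ "Suc m"] exI[of _ "x(m := x')"] exI[of _ "y(m := y')"]) (auto simp: less_Suc_eq)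
  qed
  then show ?thesis using that by blast
qed

lemma sim_sym: "sim \<Lambda> x y \<Longrightarrow> sim \<Lambda> y x"
  unfolding sim_def by metis

lemma sum_sim_sym: "sum_sim \<Lambda> a b \<Longrightarrow> sum_sim \<Lambda> b a"
  by (induction rule: sum_sim.induct) (auto intro: sum_sim.intros sim_sym)

section \<open>Shifts, transitivity and congruence of the relation\<close>

context sourceless_kgraph
begin

text \<open>Each side absorbs the shift of the other, because shifts commute. Independent
  \<open>p\<close> and \<open>q\<close> are what later makes it possible to align degrees at
  will.\<close>

lemma sim_At:
  assumes "x \<in> NV \<Lambda>" "y \<in> NV \<Lambda>" "sim \<Lambda> x y"
  shows "sim \<Lambda> (At \<Lambda> p x) (At \<Lambda> q y)"
proof -
  obtain a b where ab: "At \<Lambda> a x = At \<Lambda> b y" using assms by (auto simp: sim_def)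
  have "At \<Lambda> (a + q) (At \<Lambda> p x) = At \<Lambda> (p + q) (At \<Lambda> a x)"
    using assms by (simp add: At_At NV_ZV ac_simps)
  also have "\<dots> = At \<Lambda> (b + p) (At \<Lambda> q y)"
    using assms by (simp add: ab At_At NV_ZV ac_simps)
  finally show ?thesis unfolding sim_def by blast
qed

lemma sim_refl: "sim \<Lambda> x x"
  by (auto simp: sim_def)

lemma sum_sim_NV: "sum_sim \<Lambda> a b \<Longrightarrow> a \<in> NV \<Lambda> \<and> b \<in> NV \<Lambda>"
  by (induction rule: sum_sim.induct) auto

lemma sum_sim_At: "sum_sim \<Lambda> a b \<Longrightarrow> sum_sim \<Lambda> (At \<Lambda> p a) (At \<Lambda> q b)"
  by (induction rule: sum_sim.induct) (auto simp: At_add intro!: sum_sim.intros sim_At)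

lemma sum_sim_At_left: "sum_sim \<Lambda> a b \<Longrightarrow> sum_sim \<Lambda> (At \<Lambda> p a) b"
  and sum_sim_At_right: "sum_sim \<Lambda> a b \<Longrightarrow> sum_sim \<Lambda> a (At \<Lambda> q b)"
  using sum_sim_At[of a b p 0] sum_sim_At[of a b 0 q] sum_sim_NV[of a b]
  by (auto simp: At_zero_deg NV_ZV)

lemma sum_sim_refl: "a \<in> NV \<Lambda> \<Longrightarrow> sum_sim \<Lambda> a a"
  using sum_sim.add[OF sum_sim.zero, of a \<Lambda> a] by (simp add: sim_refl)

lemma sum_sim_add: "sum_sim \<Lambda> c d \<Longrightarrow> sum_sim \<Lambda> a b \<Longrightarrow> sum_sim \<Lambda> (a + c) (b + d)"
  by (induction rule: sum_sim.induct) (auto simp flip: add.assoc intro: sum_sim.intros)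

text \<open>Refinement of \<open>b + t = c + d\<close> says how to cut \<open>t\<close>. The partner
  \<open>s\<close> itself need not be cut accordingly, only its shift
  \<open>At p s = At q t\<close>; hence the shift of \<open>a\<close> in the conclusion.\<close>

lemma sum_sim_split:
  assumes "sum_sim \<Lambda> a b" "b = c + d" "c \<in> NV \<Lambda>" "d \<in> NV \<Lambda>"
  shows "\<exists>n a' a''. At \<Lambda> n a = a' + a'' \<and> sum_sim \<Lambda> a' c \<and> sum_sim \<Lambda> a'' d"
  using assms
proof (induction arbitrary: c d)
  case zero
  then have "c = 0" "d = 0" using NV_antisym[of c d] NV_antisym[of d c] by (auto simp: add.commute)
  then show ?case by (metis At_0 add_0 sum_sim.zero)
next
  case (add a b s t)
  have b: "b \<in> NV \<Lambda>" and a: "a \<in> NV \<Lambda>" using sum_sim_NV add(1) by auto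
  obtain b' b'' t' t'' where bt: "b' \<in> NV \<Lambda>" "b'' \<in> NV \<Lambda>" "t' \<in> NV \<Lambda>" "t'' \<in> NV \<Lambda>"
    "b = b' + b''" "t = t' + t''" "c = b' + t'" "d = b'' + t''"
    using NV_refinement[OF b add(3) add(7,8) add(6)] by metis
  obtain n a' a'' where n: "At \<Lambda> n a = a' + a''" "sum_sim \<Lambda> a' b'" "sum_sim \<Lambda> a'' b''"
    using add(5)[OF bt(5,1,2)] by blast
  obtain p q where pq: "At \<Lambda> p s = At \<Lambda> q t" using add(4) by (auto simp: sim_def)
  \<comment> \<open>One degree has to serve both parts: \<open>n\<close> splits \<open>a\<close>,
    and \<open>p\<close> splits \<open>s\<close>.\<close>
  have "At \<Lambda> (n + p) (a + s) = At \<Lambda> p (At \<Lambda> n a) + At \<Lambda> n (At \<Lambda> p s)"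
    using a add(2) by (simp add: At_At At_add NV_ZV ac_simps)
  also have "\<dots> = (At \<Lambda> p a' + At \<Lambda> n (At \<Lambda> q t')) + (At \<Lambda> p a'' + At \<Lambda> n (At \<Lambda> q t''))"
    unfolding n pq bt by (simp add: At_add ac_simps)
  finally have "At \<Lambda> (n + p) (a + s) = \<dots>" .
  moreover have "sum_sim \<Lambda> (At \<Lambda> p a' + At \<Lambda> n (At \<Lambda> q t')) c"
    unfolding bt by (intro sum_sim_add sum_sim_At_left n sum_sim_refl bt)
  moreover have "sum_sim \<Lambda> (At \<Lambda> p a'' + At \<Lambda> n (At \<Lambda> q t'')) d"
    unfolding bt by (intro sum_sim_add sum_sim_At_left n sum_sim_refl bt)
  ultimately show ?case by blast
qed

text \<open>The relation from \<open>a\<close> is cut along the summands of \<open>b\<close> by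
  \<open>sum_sim_split\<close>, and each piece is passed on to \<open>c\<close> separately. The
  shift \<open>m\<close> is there because two instances of \<open>approx\<close> may meet at
  different shifts of the middle element.\<close>

lemma sum_sim_trans:
  assumes "sum_sim \<Lambda> b c" "sum_sim \<Lambda> a (At \<Lambda> m b)"
  shows "\<exists>n k. sum_sim \<Lambda> (At \<Lambda> n a) (At \<Lambda> k c)"
  using assms
proof (induction arbitrary: a m)
  case zero
  then show ?case using sum_sim_At by fastforce
next
  case (add b c x y)
  have b: "b \<in> NV \<Lambda>" using sum_sim_NV add(1) by auto
  obtain n a' a'' where n: "At \<Lambda> n a = a' + a''" "sum_sim \<Lambda> a' (At \<Lambda> m b)" "sum_sim \<Lambda> a'' (At \<Lambda> m x)"
    using sum_sim_split[OF add(6) At_add] b add(2) by auto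
  obtain n' k where n': "sum_sim \<Lambda> (At \<Lambda> n' a') (At \<Lambda> k c)" using add(5)[OF n(2)] by blast
  obtain p q where pq: "At \<Lambda> p x = At \<Lambda> q y" using add(4) by (auto simp: sim_def)
  have NV: "a' \<in> NV \<Lambda>" "a'' \<in> NV \<Lambda>" "a \<in> NV \<Lambda>" "c \<in> NV \<Lambda>" using sum_sim_NV n add by blast+
  \<comment> \<open>A further shift of the target by \<open>p\<close> exchanges \<open>x\<close> for
    \<open>y\<close>.\<close>
  have "At \<Lambda> p (At \<Lambda> m x) = At \<Lambda> m (At \<Lambda> p x)" using add(2) by (simp add: At_At NV_ZV ac_simps)
  also have "\<dots> = At \<Lambda> (q + m) y" using add(3) by (simp add: pq At_At NV_ZV)
  finally have "sum_sim \<Lambda> a'' (At \<Lambda> (q + m) y)" using sum_sim_At_right[OF n(3), of p] by simp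
  \<comment> \<open>Both pieces must end with the same degrees, \<open>n'\<close> on the left and
    \<open>k + (q + m)\<close> on the right.\<close>
  then have y: "sum_sim \<Lambda> (At \<Lambda> n' a'') (At \<Lambda> k (At \<Lambda> (q + m) y))" by (rule sum_sim_At)
  have c: "sum_sim \<Lambda> (At \<Lambda> n' a') (At \<Lambda> (q + m) (At \<Lambda> k c))" by (rule sum_sim_At_right[OF n'])
  have "At \<Lambda> (n + n') a = At \<Lambda> n' a' + At \<Lambda> n' a''"
    using NV by (simp add: NV_ZV n At_add flip: At_At)
  moreover have "At \<Lambda> (k + (q + m)) (c + y) = At \<Lambda> (q + m) (At \<Lambda> k c) + At \<Lambda> k (At \<Lambda> (q + m) y)"
    using NV add(3) by (simp add: At_At NV_ZV At_add ac_simps)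
  ultimately show ?case using sum_sim_add[OF y c] by metis
qed

lemma approx_iff:
  "(f, g) \<in> approx \<Lambda> \<longleftrightarrow> f \<in> NV \<Lambda> \<and> g \<in> NV \<Lambda> \<and> (\<exists>p q. sum_sim \<Lambda> (At \<Lambda> p f) (At \<Lambda> q g))"
proof (intro iffI conjI)
  assume fg: "(f, g) \<in> approx \<Lambda>"
  then show NV: "f \<in> NV \<Lambda>" "g \<in> NV \<Lambda>" by (auto simp: approx_def)
  obtain m :: nat and x y where xy: "\<forall>i<m. x i \<in> NV \<Lambda> \<and> y i \<in> NV \<Lambda> \<and> sim \<Lambda> (x i) (y i)"
    and "sim \<Lambda> f (\<Sum>i<m. x i)" "sim \<Lambda> g (\<Sum>i<m. y i)"
    using fg by (auto simp: approx_def)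
  then obtain p q p' q' where "At \<Lambda> p f = At \<Lambda> p' (\<Sum>i<m. x i)" "At \<Lambda> q g = At \<Lambda> q' (\<Sum>i<m. y i)"
    by (auto simp: sim_def)
  then have "sum_sim \<Lambda> (At \<Lambda> p f) (At \<Lambda> q g)"
    using sum_sim_At[OF sum_sim_sum[of m x \<Lambda> y]] xy by simp
  then show "\<exists>p q. sum_sim \<Lambda> (At \<Lambda> p f) (At \<Lambda> q g)" by blast
next
  assume "f \<in> NV \<Lambda> \<and> g \<in> NV \<Lambda> \<and> (\<exists>p q. sum_sim \<Lambda> (At \<Lambda> p f) (At \<Lambda> q g))"
  then obtain p q where NV: "f \<in> NV \<Lambda>" "g \<in> NV \<Lambda>" and S: "sum_sim \<Lambda> (At \<Lambda> p f) (At \<Lambda> q g)" by blast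
  obtain m :: nat and x y where "\<And>i. i < m \<Longrightarrow> x i \<in> NV \<Lambda> \<and> y i \<in> NV \<Lambda> \<and> sim \<Lambda> (x i) (y i)"
    and xy: "At \<Lambda> p f = (\<Sum>i<m. x i)" "At \<Lambda> q g = (\<Sum>i<m. y i)"
    using sum_sim_obtain[OF S] by metis
  \<comment> \<open>Witnessed by the degrees \<open>p\<close> and 0 for \<open>f\<close>, and
    \<open>q\<close> and 0 for \<open>g\<close>.\<close>
  moreover have "sim \<Lambda> f (\<Sum>i<m. x i)" "sim \<Lambda> g (\<Sum>i<m. y i)"
    unfolding xy[symmetric] sim_def using NV At_zero_deg NV_ZV At_NV by metis+
  ultimately show "(f, g) \<in> approx \<Lambda>" unfolding approx_def using NV by blast
qed

lemma approx_NV: "(f, g) \<in> approx \<Lambda> \<Longrightarrow> f \<in> NV \<Lambda> \<and> g \<in> NV \<Lambda>"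
  by (simp add: approx_iff)

lemma approx_At:
  assumes "f \<in> NV \<Lambda>"
  shows "(At \<Lambda> n f, f) \<in> approx \<Lambda>"
proof -
  have "sum_sim \<Lambda> (At \<Lambda> 0 (At \<Lambda> n f)) (At \<Lambda> n f)" using assms sum_sim_refl by (simp add: At_zero_deg NV_ZV)
  then show ?thesis using assms approx_iff by auto
qed

lemma equiv_approx: "equiv (NV \<Lambda>) (approx \<Lambda>)"
proof (rule equivI)
  show "approx \<Lambda> \<subseteq> NV \<Lambda> \<times> NV \<Lambda>" using approx_NV by auto
  show "refl_on (NV \<Lambda>) (approx \<Lambda>)"
    by (auto simp: refl_on_def approx_iff intro!: sum_sim_refl[OF At_NV])
  show "sym (approx \<Lambda>)" using sum_sim_sym by (fastforce simp: sym_def approx_iff)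
  show "trans (approx \<Lambda>)"
  proof (rule transI)
    fix f g h assume "(f, g) \<in> approx \<Lambda>" "(g, h) \<in> approx \<Lambda>"
    then obtain p q p' q' where NV: "f \<in> NV \<Lambda>" "g \<in> NV \<Lambda>" "h \<in> NV \<Lambda>"
      and S: "sum_sim \<Lambda> (At \<Lambda> p f) (At \<Lambda> q g)" "sum_sim \<Lambda> (At \<Lambda> p' g) (At \<Lambda> q' h)"
      by (auto simp: approx_iff)
    \<comment> \<open>The middle elements are \<open>At q g\<close> and \<open>At p' g\<close>; an
      extra shift by \<open>p'\<close> makes the first one a shift of the second.\<close>
    have "sum_sim \<Lambda> (At \<Lambda> p f) (At \<Lambda> q (At \<Lambda> p' g))"
      using sum_sim_At_right[OF S(1), of p'] NV by (simp add: At_At NV_ZV ac_simps)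
    then obtain n k where "sum_sim \<Lambda> (At \<Lambda> n (At \<Lambda> p f)) (At \<Lambda> k (At \<Lambda> q' h))"
      using sum_sim_trans[OF S(2)] by blast
    then show "(f, h) \<in> approx \<Lambda>" using NV by (auto simp: approx_iff At_At NV_ZV)
  qed
qed

lemma approx_refl: "f \<in> NV \<Lambda> \<Longrightarrow> (f, f) \<in> approx \<Lambda>"
  and approx_sym: "(f, g) \<in> approx \<Lambda> \<Longrightarrow> (g, f) \<in> approx \<Lambda>"
  and approx_trans: "(f, g) \<in> approx \<Lambda> \<Longrightarrow> (g, h) \<in> approx \<Lambda> \<Longrightarrow> (f, h) \<in> approx \<Lambda>"
  using equiv_approx by (auto simp: equiv_def refl_on_def dest: symD transD)

lemma approx_add:
  assumes "(f, g) \<in> approx \<Lambda>" "(f', g') \<in> approx \<Lambda>"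
  shows "(f + f', g + g') \<in> approx \<Lambda>"
proof -
  obtain p q p' q' where NV: "f \<in> NV \<Lambda>" "g \<in> NV \<Lambda>" "f' \<in> NV \<Lambda>" "g' \<in> NV \<Lambda>"
    and S: "sum_sim \<Lambda> (At \<Lambda> p f) (At \<Lambda> q g)" "sum_sim \<Lambda> (At \<Lambda> p' f') (At \<Lambda> q' g')"
    using assms by (auto simp: approx_iff)
  have "sum_sim \<Lambda> (At \<Lambda> (p + p') (f + f')) (At \<Lambda> (q + q') (g + g'))"
    using sum_sim_add[OF sum_sim_At[OF S(2), of p q] sum_sim_At[OF S(1), of p' q']] NV
    by (simp add: At_At NV_ZV At_add ac_simps)
  then show ?thesis using NV by (auto simp: approx_iff)
qed

lemma approx_sum:
  "(\<And>i. i \<in> I \<Longrightarrow> (x i, y i) \<in> approx \<Lambda>) \<Longrightarrow> (sum x I, sum y I) \<in> approx \<Lambda>"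
  by (induction I rule: infinite_finite_induct) (auto simp: approx_refl intro: approx_add)

text \<open>Shifts detect 0, and nonnegative summands of 0 vanish. So the identity of the semigroup
  is represented by 0 alone.\<close>

lemma approx_zero_iff: "(f, 0) \<in> approx \<Lambda> \<longleftrightarrow> f = 0"
proof
  have "b = 0 \<longrightarrow> a = 0" if "sum_sim \<Lambda> a b" for a b
    using that
  proof induction
    case (add a b x y)
    have "x = 0" if "y = 0" using add(2,4) that At_eq_0_iff by (auto simp: sim_def)
    then show ?case
      using add NV_antisym[of b y] NV_antisym[of y b] sum_sim_NV[of a b] by (auto simp: add.commute)
  qed simp
  then show "f = 0" if "(f, 0) \<in> approx \<Lambda>" using that At_eq_0_iff by (auto simp: approx_iff)
  show "f = 0 \<Longrightarrow> (f, 0) \<in> approx \<Lambda>" using sum_sim.zero by (auto simp: approx_iff)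
qed

text \<open>Two summands with a common shift take the same value, and \<open>sum_sim\<close> only
  adds up such pairs. This is the universal property of the quotient, through which a graph trace
  descends to classes.\<close>

lemma approx_invariant:
  assumes "(f, g) \<in> approx \<Lambda>"
    and add: "\<And>f g. f \<in> NV \<Lambda> \<Longrightarrow> g \<in> NV \<Lambda> \<Longrightarrow> \<phi> (f + g) = \<phi> f + \<phi> g"
    and At: "\<And>n f. f \<in> NV \<Lambda> \<Longrightarrow> \<phi> (At \<Lambda> n f) = \<phi> f"
  shows "\<phi> f = \<phi> g"
proof -
  have "\<phi> a = \<phi> b" if "sum_sim \<Lambda> a b" for a b
    using that
  proof induction
    case (add a b x y)
    have "\<phi> x = \<phi> y" using add(2-4) At by (metis sim_def)
    then show ?case using add assms(2) sum_sim_NV[of a b] by simp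
  qed simp
  then show ?thesis using assms(1) At by (auto simp: approx_iff) metis
qed

section \<open>Computing in the semigroup with representatives\<close>

definition cls :: "('a \<Rightarrow>\<^sub>0 int) \<Rightarrow> ('a \<Rightarrow>\<^sub>0 int) set" where
  "cls f = approx \<Lambda> `` {f}"

lemma cls_eq_iff: "f \<in> NV \<Lambda> \<Longrightarrow> g \<in> NV \<Lambda> \<Longrightarrow> cls f = cls g \<longleftrightarrow> (f, g) \<in> approx \<Lambda>"
  unfolding cls_def by (rule eq_equiv_class_iff[OF equiv_approx])

lemma carrier_eq: "carrier (graph_semigroup \<Lambda>) = cls ` NV \<Lambda>"
  by (auto simp: graph_semigroup_simps quotient_def cls_def)

lemma one_eq: "\<one>\<^bsub>graph_semigroup \<Lambda>\<^esub> = cls 0"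
  by (simp add: graph_semigroup_simps cls_def)

text \<open>The union over all representatives collapses because \<open>approx\<close> is a
  congruence.\<close>

lemma mult_eq:
  assumes "f \<in> NV \<Lambda>" "g \<in> NV \<Lambda>"
  shows "cls f \<otimes>\<^bsub>graph_semigroup \<Lambda>\<^esub> cls g = cls (f + g)"
proof -
  have "approx \<Lambda> `` {f' + g'} = cls (f + g)" if "f' \<in> cls f" "g' \<in> cls g" for f' g'
    using cls_eq_iff[of "f + g" "f' + g'"] approx_add[of f f' g g'] approx_NV that
    by (auto simp: cls_def)
  moreover have "f \<in> cls f" "g \<in> cls g" using assms equiv_class_self[OF equiv_approx] by (auto simp: cls_def)
  ultimately show ?thesis unfolding graph_semigroup_simps by blast
qed

lemma cls_eq_one_iff: "f \<in> NV \<Lambda> \<Longrightarrow> cls f = \<one>\<^bsub>graph_semigroup \<Lambda>\<^esub> \<longleftrightarrow> f = 0"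
  unfolding one_eq by (simp add: cls_eq_iff approx_zero_iff)

lemma pow_eq:
  assumes "f \<in> NV \<Lambda>"
  shows "cls f [^]\<^bsub>graph_semigroup \<Lambda>\<^esub> (n::nat) = cls (frag_cmul (int n) f)"
proof (induction n)
  case 0
  then show ?case by (simp add: nat_pow_def one_eq)
next
  case (Suc n)
  then show ?case
    using assms mult_eq[of "frag_cmul (int n) f" f]
    by (simp add: nat_pow_def NV_cmul frag_cmul_distrib add.commute)
qed

lemma prec_iff:
  assumes "f \<in> NV \<Lambda>" "g \<in> NV \<Lambda>"
  shows "cls f \<preceq>\<^bsub>graph_semigroup \<Lambda>\<^esub> cls g \<longleftrightarrow> (\<exists>h\<in>NV \<Lambda>. (f + h, g) \<in> approx \<Lambda>)"
  unfolding graph_semigroup_simps(4) carrier_eq using assms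
  by (auto simp: mult_eq cls_eq_iff)

end

section \<open>Graph traces as functionals\<close>

text \<open>Defined on all finitely supported functions, so that it is a
  \<open>Modules.additive\<close> map without side conditions.\<close>

definition trace_ext :: "('a \<Rightarrow> real) \<Rightarrow> ('a \<Rightarrow>\<^sub>0 int) \<Rightarrow> real" where
  "trace_ext \<tau> f = (\<Sum>v\<in>Poly_Mapping.keys f. of_int (Poly_Mapping.lookup f v) * \<tau> v)"

lemma trace_ext_superset:
  assumes "Poly_Mapping.keys f \<subseteq> A" "finite A"
  shows "trace_ext \<tau> f = (\<Sum>v\<in>A. of_int (Poly_Mapping.lookup f v) * \<tau> v)"
  unfolding trace_ext_def by (rule sum.mono_neutral_left) (use assms in \<open>auto simp: in_keys_iff\<close>)

lemma additive_trace_ext: "Modules.additive (trace_ext \<tau>)"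
proof
  fix f g :: "'a \<Rightarrow>\<^sub>0 int"
  let ?A = "Poly_Mapping.keys f \<union> Poly_Mapping.keys g"
  have "trace_ext \<tau> h = (\<Sum>v\<in>?A. of_int (Poly_Mapping.lookup h v) * \<tau> v)" if "h \<in> {f, g, f + g}" for h
    using that Poly_Mapping.keys_add[of f g] by (intro trace_ext_superset) auto
  then show "trace_ext \<tau> (f + g) = trace_ext \<tau> f + trace_ext \<tau> g"
    by (simp add: lookup_add algebra_simps sum.distrib)
qed

lemma trace_ext_frag_of [simp]: "trace_ext \<tau> (frag_of v) = \<tau> v"
  by (simp add: trace_ext_def keys_frag_of)

lemma additive_frag_cmul:
  assumes "Modules.additive (\<phi> :: ('a \<Rightarrow>\<^sub>0 int) \<Rightarrow> real)"
  shows "\<phi> (frag_cmul (int n) f) = real n * \<phi> f"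
proof -
  interpret Modules.additive \<phi> by fact
  show ?thesis by (induction n) (auto simp: zero add frag_cmul_distrib algebra_simps)
qed

context sourceless_kgraph
begin

lemma trace_ext_At:
  assumes "faithful_graph_trace \<Lambda> \<tau>" "f \<in> ZV \<Lambda>"
  shows "trace_ext \<tau> (At \<Lambda> n f) = trace_ext \<tau> f"
proof -
  interpret Modules.additive "trace_ext \<tau>" by (rule additive_trace_ext)
  show ?thesis using assms(2)
    by (induction rule: ZV_induct)
      (use assms(1) in \<open>auto simp: zero diff At_diff At_frag_of sum faithful_graph_trace_def\<close>)
qed

lemma trace_ext_nonneg:
  assumes "faithful_graph_trace \<Lambda> \<tau>" "f \<in> NV \<Lambda>"
  shows "0 \<le> trace_ext \<tau> f"
  unfolding trace_ext_def
  by (rule sum_nonneg) (use assms in \<open>auto simp: faithful_graph_trace_def NV_def ZV_def less_imp_le subset_iff\<close>)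

lemma trace_ext_pos:
  assumes "faithful_graph_trace \<Lambda> \<tau>" "f \<in> NV \<Lambda>" "f \<noteq> 0"
  shows "0 < trace_ext \<tau> f"
proof -
  obtain v g where "v \<in> vertices \<Lambda>" "g \<in> NV \<Lambda>" "f = g + frag_of v" using NV_cases assms by metis
  then show ?thesis using assms(1) trace_ext_nonneg[of \<tau> g] additive.add[OF additive_trace_ext, of \<tau>]
    by (auto simp: faithful_graph_trace_def intro: add_nonneg_pos)
qed

lemma trace_ext_approx:
  assumes "faithful_graph_trace \<Lambda> \<tau>" "(f, g) \<in> approx \<Lambda>"
  shows "trace_ext \<tau> f = trace_ext \<tau> g"
  using assms(2)
  by (rule approx_invariant)
    (use assms(1) in \<open>auto simp: trace_ext_At NV_ZV additive.add[OF additive_trace_ext]\<close>)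

section \<open>The subgroup of coboundaries\<close>

abbreviation coboundaries :: "('a \<Rightarrow>\<^sub>0 int) set" where
  "coboundaries \<equiv> \<Sum>i\<in>UNIV. im_one_minus_At \<Lambda> i"

lemma coboundaries_iff:
  "f \<in> coboundaries \<longleftrightarrow>
    (\<exists>h. (\<forall>i. h i \<in> ZV \<Lambda>) \<and> f = (\<Sum>i\<in>UNIV. h i - At \<Lambda> (axis i 1) (h i)))"
proof -
  have "f \<in> coboundaries \<longleftrightarrow> (\<exists>s. f = sum s UNIV \<and> (\<forall>i. s i \<in> im_one_minus_At \<Lambda> i))"
    by (simp add: set_sum_alt)
  also have "\<dots> \<longleftrightarrow> (\<exists>h. (\<forall>i. h i \<in> ZV \<Lambda>) \<and> f = (\<Sum>i\<in>UNIV. h i - At \<Lambda> (axis i 1) (h i)))"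
    (is "?L \<longleftrightarrow> ?R")
  proof
    assume ?L
    then obtain s where s: "f = sum s UNIV" "\<forall>i. \<exists>h. h \<in> ZV \<Lambda> \<and> s i = h - At \<Lambda> (axis i 1) h"
      by (auto simp: im_one_minus_At_def image_iff Bex_def)
    obtain h where "\<forall>i. h i \<in> ZV \<Lambda> \<and> s i = h i - At \<Lambda> (axis i 1) (h i)" using choice[OF s(2)] by blast
    then show ?R using s(1) by (intro exI[of _ h]) simp
  next
    assume ?R
    then obtain h where "\<forall>i. h i \<in> ZV \<Lambda>" "f = (\<Sum>i\<in>UNIV. h i - At \<Lambda> (axis i 1) (h i))" by blast
    then show ?L
      by (intro exI[of _ "\<lambda>i. h i - At \<Lambda> (axis i 1) (h i)"]) (simp add: im_one_minus_At_def)
  qed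
  finally show ?thesis .
qed

lemma coboundaries_zero: "0 \<in> coboundaries"
  unfolding coboundaries_iff by (intro exI[of _ "\<lambda>_. 0"]) simp

lemma coboundaries_diff:
  assumes "f \<in> coboundaries" "g \<in> coboundaries"
  shows "f - g \<in> coboundaries"
proof -
  obtain h where h: "\<forall>i. h i \<in> ZV \<Lambda>" "f = (\<Sum>i\<in>UNIV. h i - At \<Lambda> (axis i 1) (h i))"
    using assms(1) unfolding coboundaries_iff by blast
  obtain h' where h': "\<forall>i. h' i \<in> ZV \<Lambda>" "g = (\<Sum>i\<in>UNIV. h' i - At \<Lambda> (axis i 1) (h' i))"
    using assms(2) unfolding coboundaries_iff by blast
  have "f - g = (\<Sum>i\<in>UNIV. (h i - h' i) - At \<Lambda> (axis i 1) (h i - h' i))"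
    unfolding h(2) h'(2) sum_subtractf[symmetric] by (rule sum.cong) (simp_all add: At_diff)
  then show ?thesis
    unfolding coboundaries_iff using h(1) h'(1) by (intro exI[of _ "\<lambda>i. h i - h' i"]) (simp add: ZV_diff)
qed

lemma coboundaries_uminus: "f \<in> coboundaries \<Longrightarrow> - f \<in> coboundaries"
  using coboundaries_diff[OF coboundaries_zero, of f] by simp

lemma coboundaries_add: "f \<in> coboundaries \<Longrightarrow> g \<in> coboundaries \<Longrightarrow> f + g \<in> coboundaries"
  using coboundaries_diff[OF _ coboundaries_uminus, of f g] by simp

lemma coboundaries_ZV: "f \<in> coboundaries \<Longrightarrow> f \<in> ZV \<Lambda>"
proof -
  assume "f \<in> coboundaries"
  then obtain h where h: "\<forall>i. h i \<in> ZV \<Lambda>" "f = (\<Sum>i\<in>UNIV. h i - At \<Lambda> (axis i 1) (h i))"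
    unfolding coboundaries_iff by blast
  have "(\<Sum>i\<in>I. h i - At \<Lambda> (axis i 1) (h i)) \<in> ZV \<Lambda>" for I :: "'b set"
    by (induction I rule: infinite_finite_induct) (auto simp: h(1) ZV_add ZV_diff At_ZV)
  then show ?thesis unfolding h(2) .
qed

lemma coboundaries_axis:
  assumes "f \<in> ZV \<Lambda>"
  shows "f - At \<Lambda> (axis i 1) f \<in> coboundaries"
  unfolding coboundaries_iff
proof (intro exI[of _ "\<lambda>j. if j = i then f else 0"] conjI allI)
  have "(\<Sum>j\<in>UNIV. (if j = i then f else 0) - At \<Lambda> (axis j 1) (if j = i then f else 0)) =
    (\<Sum>j\<in>UNIV. if j = i then f - At \<Lambda> (axis i 1) f else 0)"
    by (rule sum.cong) auto
  then show "f - At \<Lambda> (axis i 1) f =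
    (\<Sum>j\<in>UNIV. (if j = i then f else 0) - At \<Lambda> (axis j 1) (if j = i then f else 0))" by simp
qed (use assms in auto)

text \<open>The difference telescopes along a chain of generators from 0 to
  \<open>n\<close>.\<close>

lemma coboundaries_At:
  assumes "f \<in> ZV \<Lambda>"
  shows "f - At \<Lambda> n f \<in> coboundaries"
proof (induction n rule: nat_vec_induct)
  case zero
  then show ?case using assms coboundaries_zero by (simp add: At_zero_deg)
next
  case (step n i)
  have "f - At \<Lambda> (n + axis i 1) f = (f - At \<Lambda> n f) + (At \<Lambda> n f - At \<Lambda> (axis i 1) (At \<Lambda> n f))"
    using assms by (simp add: At_At)
  then show ?case using coboundaries_add[OF step coboundaries_axis[OF At_ZV[OF assms]]] by metis
qed

text \<open>Shifts change nothing modulo coboundaries, so S(\<Lambda>) maps to the quotient group.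
  This carries domination between classes over to the ordered group.\<close>

lemma coboundaries_approx:
  assumes "(f, g) \<in> approx \<Lambda>"
  shows "f - g \<in> coboundaries"
proof -
  have via: "x - y \<in> coboundaries"
    if "x \<in> NV \<Lambda>" "y \<in> NV \<Lambda>" "At \<Lambda> p x - At \<Lambda> q y \<in> coboundaries" for x y p q
  proof -
    have "(x - At \<Lambda> p x) + (At \<Lambda> p x - At \<Lambda> q y) - (y - At \<Lambda> q y) \<in> coboundaries"
      by (rule coboundaries_diff[OF coboundaries_add]; (rule coboundaries_At NV_ZV that)+)
    then show ?thesis by simp
  qed
  have "a - b \<in> coboundaries" if "sum_sim \<Lambda> a b" for a b
    using that
  proof induction
    case (add a b x y)
    obtain p q where "At \<Lambda> p x = At \<Lambda> q y" using add(4) by (auto simp: sim_def)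
    then have "x - y \<in> coboundaries" using via[of x y p q] add coboundaries_zero by simp
    then have "(a - b) + (x - y) \<in> coboundaries" using coboundaries_add[OF add(5)] by blast
    then show ?case by (simp add: add_diff_add)
  qed (simp add: coboundaries_zero)
  moreover obtain p q where "f \<in> NV \<Lambda>" "g \<in> NV \<Lambda>" "sum_sim \<Lambda> (At \<Lambda> p f) (At \<Lambda> q g)"
    using assms by (auto simp: approx_iff)
  ultimately show ?thesis using via by blast
qed

section \<open>What stable finiteness and a graph trace entail\<close>

lemma stably_finite_imp_coboundaries:
  assumes "stably_finite (graph_semigroup \<Lambda>)"
  shows "coboundaries \<inter> NV \<Lambda> = {0}"
proof -
  have "f = 0" if f: "f \<in> coboundaries" "f \<in> NV \<Lambda>" for f
  proof (rule ccontr)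
    assume "f \<noteq> 0"
    obtain h where h: "\<forall>i. h i \<in> ZV \<Lambda>" "f = (\<Sum>i\<in>UNIV. h i - At \<Lambda> (axis i 1) (h i))"
      using f(1) unfolding coboundaries_iff by blast
    obtain a b where ab: "\<And>i. a i \<in> NV \<Lambda>" "\<And>i. b i \<in> NV \<Lambda>" "\<And>i. h i = a i - b i"
    proof -
      have "\<forall>i. \<exists>c. fst c \<in> NV \<Lambda> \<and> snd c \<in> NV \<Lambda> \<and> h i = fst c - snd c"
        using ZV_decompose h(1) by (simp add: split_paired_Ex)
      from choice[OF this] obtain c where "\<forall>i. fst (c i) \<in> NV \<Lambda> \<and> snd (c i) \<in> NV \<Lambda> \<and> h i = fst (c i) - snd (c i)" ..
      then show thesis using that[of "fst \<circ> c" "snd \<circ> c"] by simp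
    qed
    define x where "x = (\<Sum>i\<in>UNIV. a i + b i)"
    have x: "x \<in> NV \<Lambda>" unfolding x_def by (intro NV_sum NV_add ab)
    have 1: "((\<Sum>i\<in>UNIV. At \<Lambda> (axis i 1) (a i) + b i), x) \<in> approx \<Lambda>"
      unfolding x_def by (intro approx_sum approx_add approx_At approx_refl ab)
    have 2: "((\<Sum>i\<in>UNIV. a i + At \<Lambda> (axis i 1) (b i)), x) \<in> approx \<Lambda>"
      unfolding x_def by (intro approx_sum approx_add approx_At approx_refl ab)
    \<comment> \<open>Adding \<open>f\<close> undoes the shifts of the \<open>a i\<close> and
      imposes shifts on the \<open>b i\<close> instead; both sums represent the class of
      \<open>x\<close>.\<close>
    have "(\<Sum>i\<in>UNIV. At \<Lambda> (axis i 1) (a i) + b i) + f = (\<Sum>i\<in>UNIV. a i + At \<Lambda> (axis i 1) (b i))"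
      unfolding h(2) ab(3) sum.distrib[symmetric] by (rule sum.cong) (auto simp: At_diff)
    then have "(x + f, x) \<in> approx \<Lambda>"
      using approx_trans[OF approx_sym[OF approx_add[OF 1 approx_refl[OF f(2)]]]] 2 by simp
    \<comment> \<open>Were \<open>x\<close> zero, \<open>f\<close> would lie in the class of
      0.\<close>
    moreover from this have "x \<noteq> 0" using \<open>f \<noteq> 0\<close> by (auto simp: approx_zero_iff)
    ultimately have "infinite_element (graph_semigroup \<Lambda>) (cls x)"
      unfolding infinite_element_def using x f \<open>f \<noteq> 0\<close>
      by (auto simp: carrier_eq cls_eq_one_iff mult_eq cls_eq_iff intro!: bexI[of _ f])
    then show False using assms by (auto simp: stably_finite_def)
  qed
  then show ?thesis using coboundaries_zero by auto
qed

lemma faithful_graph_trace_imp_pow_not_prec: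
  assumes "faithful_graph_trace \<Lambda> \<tau>" and x: "x \<in> carrier (graph_semigroup \<Lambda>)" "x \<noteq> \<one>\<^bsub>graph_semigroup \<Lambda>\<^esub>"
  shows "\<not> x [^]\<^bsub>graph_semigroup \<Lambda>\<^esub> (n + 1 :: nat) \<preceq>\<^bsub>graph_semigroup \<Lambda>\<^esub> x [^]\<^bsub>graph_semigroup \<Lambda>\<^esub> n"
proof
  obtain f where "f \<in> NV \<Lambda>" "x = cls f" using x(1) by (auto simp: carrier_eq)
  moreover from this have "f \<noteq> 0" using x(2) by (auto simp: cls_eq_one_iff)
  ultimately have f: "f \<in> NV \<Lambda>" "x = cls f" "f \<noteq> 0" by blast+
  assume "x [^]\<^bsub>graph_semigroup \<Lambda>\<^esub> (n + 1) \<preceq>\<^bsub>graph_semigroup \<Lambda>\<^esub> x [^]\<^bsub>graph_semigroup \<Lambda>\<^esub> n"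
  then obtain h where h: "h \<in> NV \<Lambda>"
    "(frag_cmul (int (n + 1)) f + h, frag_cmul (int n) f) \<in> approx \<Lambda>"
    unfolding f(2) pow_eq[OF f(1)] prec_iff[OF NV_cmul[OF f(1)] NV_cmul[OF f(1)]] by blast
  have "real (n + 1) * trace_ext \<tau> f + trace_ext \<tau> h = real n * trace_ext \<tau> f"
    using trace_ext_approx[OF assms(1) h(2)]
    unfolding additive.add[OF additive_trace_ext] additive_frag_cmul[OF additive_trace_ext] .
  then show False using trace_ext_nonneg[OF assms(1) h(1)] trace_ext_pos[OF assms(1) f(1,3)]
    by (simp add: algebra_simps)
qed

lemma vertex_exists: "\<exists>v. v \<in> vertices \<Lambda>"
  using nonempty rg_in_vertices by auto

lemma faithful_graph_trace_imp_state:
  assumes \<tau>: "faithful_graph_trace \<Lambda> \<tau>"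
  shows "\<exists>\<phi>. nontrivial_state (graph_semigroup \<Lambda>) \<phi>"
proof -
  define \<phi> where "\<phi> X = ennreal (trace_ext \<tau> (SOME f. f \<in> X))" for X
  have \<phi>: "\<phi> (cls f) = ennreal (trace_ext \<tau> f)" if "f \<in> NV \<Lambda>" for f
  proof -
    have "f \<in> cls f" using that by (simp add: cls_def approx_refl)
    then have "(SOME f'. f' \<in> cls f) \<in> cls f" by (rule someI)
    then have "(f, SOME f'. f' \<in> cls f) \<in> approx \<Lambda>" by (simp add: cls_def)
    then show ?thesis using trace_ext_approx[OF \<tau>] by (simp add: \<phi>_def)
  qed
  have add: "\<phi> (x \<otimes>\<^bsub>graph_semigroup \<Lambda>\<^esub> y) = \<phi> x + \<phi> y"
    if "x \<in> carrier (graph_semigroup \<Lambda>)" "y \<in> carrier (graph_semigroup \<Lambda>)" for x y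
    using that unfolding carrier_eq
    by (auto simp: mult_eq \<phi> additive.add[OF additive_trace_ext] ennreal_plus trace_ext_nonneg[OF \<tau>])
  \<comment> \<open>The preorder is algebraic, so additivity with values in \<open>ennreal\<close>
    already gives monotonicity.\<close>
  moreover have "\<phi> x \<le> \<phi> y"
    if "x \<in> carrier (graph_semigroup \<Lambda>)" "x \<preceq>\<^bsub>graph_semigroup \<Lambda>\<^esub> y" for x y
    using that add unfolding graph_semigroup_simps(4) by auto
  moreover have "\<phi> \<one>\<^bsub>graph_semigroup \<Lambda>\<^esub> = 0"
    by (simp add: one_eq \<phi> additive.zero[OF additive_trace_ext])
  ultimately have "is_state (graph_semigroup \<Lambda>) \<phi>" by (simp add: is_state_def)
  moreover obtain v where v: "v \<in> vertices \<Lambda>" using vertex_exists by blast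
  then have "\<phi> (cls (frag_of v)) = ennreal (\<tau> v)" "0 < \<tau> v"
    using \<tau> by (auto simp: \<phi> NV_frag_of faithful_graph_trace_def)
  then have "\<phi> (cls (frag_of v)) \<noteq> 0" "\<phi> (cls (frag_of v)) \<noteq> \<infinity>" by auto
  ultimately show ?thesis using v NV_frag_of unfolding nontrivial_state_def carrier_eq by blast
qed

end

section \<open>Cofinality\<close>

context sourceless_kgraph
begin

text \<open>The relation f \<le> n g in the semigroup, read on representatives. Its slack
  \<open>h\<close> stays explicit, because states and functionals are evaluated on it later.\<close>

definition dominated :: "('a \<Rightarrow>\<^sub>0 int) \<Rightarrow> ('a \<Rightarrow>\<^sub>0 int) \<Rightarrow> bool" where
  "dominated f g \<longleftrightarrow> (\<exists>n::nat. \<exists>h\<in>NV \<Lambda>. (f + h, frag_cmul (int n) g) \<in> approx \<Lambda>)"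

lemma dominated_zero: "dominated 0 g"
  unfolding dominated_def using approx_refl[of 0] by (intro exI[of _ 0] bexI[of _ 0]) auto

lemma dominated_add:
  assumes "dominated f g" "dominated f' g"
  shows "dominated (f + f') g"
proof -
  obtain n h n' h' where *: "h \<in> NV \<Lambda>" "h' \<in> NV \<Lambda>"
    "(f + h, frag_cmul (int n) g) \<in> approx \<Lambda>" "(f' + h', frag_cmul (int n') g) \<in> approx \<Lambda>"
    using assms by (auto simp: dominated_def)
  have "(f + f' + (h + h'), frag_cmul (int (n + n')) g) \<in> approx \<Lambda>"
    using approx_add[OF *(3,4)] by (simp add: frag_cmul_distrib ac_simps)
  then show ?thesis unfolding dominated_def using *(1,2) NV_add by blast
qed

lemma dominated_sum:
  "(\<And>i. i \<in> I \<Longrightarrow> dominated (x i) g) \<Longrightarrow> dominated (sum x I) g"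
  by (induction I rule: infinite_finite_induct) (auto simp: dominated_zero dominated_add)

lemma dominated_approx:
  assumes "(f, f') \<in> approx \<Lambda>" "dominated f' g"
  shows "dominated f g"
proof -
  obtain n h where h: "h \<in> NV \<Lambda>" "(f' + h, frag_cmul (int n) g) \<in> approx \<Lambda>"
    using assms(2) by (auto simp: dominated_def)
  have "(f + h, frag_cmul (int n) g) \<in> approx \<Lambda>"
    by (rule approx_trans[OF approx_add[OF assms(1) approx_refl[OF h(1)]] h(2)])
  then show ?thesis unfolding dominated_def using h(1) by blast
qed

text \<open>A vertex has the class of its shift by the degree of \<open>\<kappa>\<close>, and
  \<open>sr \<Lambda> \<kappa>\<close> is one summand of that shift; the multiple is 1.\<close>

lemma dominated_sr:
  assumes "\<kappa> \<in> paths \<Lambda>"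
  shows "dominated (frag_of (sr \<Lambda> \<kappa>)) (frag_of (rg \<Lambda> \<kappa>))"
proof -
  obtain g where g: "g \<in> NV \<Lambda>" "At \<Lambda> (deg \<Lambda> \<kappa>) (frag_of (rg \<Lambda> \<kappa>)) = g + frag_of (sr \<Lambda> \<kappa>)"
    using At_frag_of_cases[OF paths_from_degI[OF assms]] .
  have "(frag_of (sr \<Lambda> \<kappa>) + g, frag_cmul (int 1) (frag_of (rg \<Lambda> \<kappa>))) \<in> approx \<Lambda>"
    using approx_At[OF NV_frag_of[OF rg_in_vertices[OF assms]], of "deg \<Lambda> \<kappa>"]
    by (simp add: g(2) add.commute)
  then show ?thesis unfolding dominated_def using g(1) by blast
qed

end

locale cofinal_kgraph = sourceless_kgraph +
  assumes cofinal: "kgraph_cofinal \<Lambda>"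
begin

text \<open>Cofinality makes every source of a path in \<open>paths_from_deg \<Lambda> w n\<close>
  the source of a path out of \<open>v\<close>, hence dominated by \<open>v\<close>; and
  \<open>w\<close> has the class of the sum of these sources.\<close>

lemma dominated_frag_of:
  assumes "v \<in> vertices \<Lambda>" "w \<in> vertices \<Lambda>"
  shows "dominated (frag_of w) (frag_of v)"
proof -
  obtain n where n: "sr \<Lambda> ` paths_from_deg \<Lambda> w n \<subseteq> sr \<Lambda> ` paths_from \<Lambda> v"
    using cofinal assms unfolding kgraph_cofinal_def by blast
  have "dominated (frag_of (sr \<Lambda> \<kappa>)) (frag_of v)" if k: "\<kappa> \<in> paths_from_deg \<Lambda> w n" for \<kappa>
  proof -
    obtain \<nu> where "\<nu> \<in> paths \<Lambda>" "rg \<Lambda> \<nu> = v" "sr \<Lambda> \<kappa> = sr \<Lambda> \<nu>"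
      using n k by (auto simp: paths_from_def)
    then show ?thesis using dominated_sr by metis
  qed
  then have "dominated (At \<Lambda> n (frag_of w)) (frag_of v)"
    unfolding At_frag_of by (rule dominated_sum)
  then show ?thesis
    by (rule dominated_approx[OF approx_sym[OF approx_At[OF NV_frag_of[OF assms(2)]]]])
qed

lemma dominated:
  assumes "f \<in> NV \<Lambda>" "g \<in> NV \<Lambda>" "g \<noteq> 0"
  shows "dominated f g"
proof -
  obtain v g' where g: "v \<in> vertices \<Lambda>" "g' \<in> NV \<Lambda>" "g = g' + frag_of v"
    using NV_cases assms(2,3) by metis
  have "dominated f (frag_of v)"
    using assms(1) by (induction rule: NV_induct) (auto intro: dominated_zero dominated_add dominated_frag_of g)
  then obtain n h where h: "h \<in> NV \<Lambda>" "(f + h, frag_cmul (int n) (frag_of v)) \<in> approx \<Lambda>"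
    by (auto simp: dominated_def)
  \<comment> \<open>The part of \<open>g\<close> other than the chosen vertex goes into the
    slack.\<close>
  have "(f + (h + frag_cmul (int n) g'), frag_cmul (int n) g) \<in> approx \<Lambda>"
    using approx_add[OF h(2) approx_refl[OF NV_cmul[OF g(2)]]]
    by (simp add: g(3) frag_cmul_distrib2 ac_simps)
  then show ?thesis unfolding dominated_def using NV_add[OF h(1) NV_cmul[OF g(2)]] by blast
qed

section \<open>Implications that use domination\<close>

lemma pow_not_prec_imp_stably_finite:
  assumes "\<And>x n. \<lbrakk>x \<in> carrier (graph_semigroup \<Lambda>); x \<noteq> \<one>\<^bsub>graph_semigroup \<Lambda>\<^esub>\<rbrakk> \<Longrightarrow>
    \<not> x [^]\<^bsub>graph_semigroup \<Lambda>\<^esub> (n + 1 :: nat) \<preceq>\<^bsub>graph_semigroup \<Lambda>\<^esub> x [^]\<^bsub>graph_semigroup \<Lambda>\<^esub> n"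
  shows "stably_finite (graph_semigroup \<Lambda>)"
  unfolding stably_finite_def
proof
  assume "\<exists>x. infinite_element (graph_semigroup \<Lambda>) x"
  then obtain x y where x: "x \<in> carrier (graph_semigroup \<Lambda>)" "x \<noteq> \<one>\<^bsub>graph_semigroup \<Lambda>\<^esub>"
    and y: "y \<in> carrier (graph_semigroup \<Lambda>)" "y \<noteq> \<one>\<^bsub>graph_semigroup \<Lambda>\<^esub>"
    and xy: "x \<otimes>\<^bsub>graph_semigroup \<Lambda>\<^esub> y = x"
    unfolding infinite_element_def by blast
  obtain f where f: "f \<in> NV \<Lambda>" "x = cls f" using x(1) by (auto simp: carrier_eq)
  obtain g where g: "g \<in> NV \<Lambda>" "y = cls g" using y(1) by (auto simp: carrier_eq)
  have "g \<noteq> 0" using y(2) g by (auto simp: cls_eq_one_iff)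
  have fg: "(f + g, f) \<in> approx \<Lambda>" using xy f g by (simp add: mult_eq cls_eq_iff)
  have absorb: "(f + frag_cmul (int n) g, f) \<in> approx \<Lambda>" for n
  proof (induction n)
    case 0
    then show ?case using f approx_refl by simp
  next
    case (Suc n)
    have "(f + frag_cmul (int n) g + g, f + g) \<in> approx \<Lambda>"
      by (rule approx_add[OF Suc approx_refl[OF g(1)]])
    from approx_trans[OF this fg] show ?case by (simp add: frag_cmul_distrib ac_simps)
  qed
  obtain n h where h: "h \<in> NV \<Lambda>" "(f + h, frag_cmul (int n) g) \<in> approx \<Lambda>"
    using dominated[OF f(1) g(1) \<open>g \<noteq> 0\<close>] by (auto simp: dominated_def)
  have "(f + (f + h), f) \<in> approx \<Lambda>"
    by (rule approx_trans[OF approx_add[OF approx_refl[OF f(1)] h(2)] absorb])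
  \<comment> \<open>The coefficients take the shape of the hypothesis at n = 1.\<close>
  moreover have "f + (f + h) = frag_cmul (int (1 + 1)) f + h"
    unfolding of_nat_add frag_cmul_distrib by (simp add: add.assoc)
  ultimately have "(frag_cmul (int (1 + 1)) f + h, frag_cmul (int 1) f) \<in> approx \<Lambda>"
    by simp
  then have "x [^]\<^bsub>graph_semigroup \<Lambda>\<^esub> (1 + 1 :: nat) \<preceq>\<^bsub>graph_semigroup \<Lambda>\<^esub> x [^]\<^bsub>graph_semigroup \<Lambda>\<^esub> (1 :: nat)"
    unfolding f(2) pow_eq[OF f(1)] prec_iff[OF NV_cmul[OF f(1)] NV_cmul[OF f(1)]] using h(1) by blast
  then show False using assms[OF x] by blast
qed

lemma state_imp_faithful_graph_trace:
  assumes "nontrivial_state (graph_semigroup \<Lambda>) \<phi>"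
  shows "\<exists>\<tau>. faithful_graph_trace \<Lambda> \<tau>"
proof -
  define \<psi> where "\<psi> f = \<phi> (cls f)" for f
  have add: "\<psi> (f + g) = \<psi> f + \<psi> g" if "f \<in> NV \<Lambda>" "g \<in> NV \<Lambda>" for f g
    using assms that unfolding nontrivial_state_def is_state_def carrier_eq \<psi>_def
    by (simp flip: mult_eq)
  have zero: "\<psi> 0 = 0"
    using assms unfolding nontrivial_state_def is_state_def one_eq \<psi>_def by simp
  have approx: "\<psi> f = \<psi> g" if "(f, g) \<in> approx \<Lambda>" for f g
    using that approx_NV[OF that] cls_eq_iff unfolding \<psi>_def by metis
  have sum: "\<psi> (sum x I) = (\<Sum>i\<in>I. \<psi> (x i))" if "\<And>i. i \<in> I \<Longrightarrow> x i \<in> NV \<Lambda>" for x and I :: "'a set"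
    using that by (induction I rule: infinite_finite_induct) (auto simp: zero add NV_sum)
  have cmul: "\<psi> (frag_cmul (int n) f) = of_nat n * \<psi> f" if "f \<in> NV \<Lambda>" for n f
    using that by (induction n) (auto simp: zero add NV_cmul frag_cmul_distrib algebra_simps)
  \<comment> \<open>This single value in (0, \<infinity>) is all that nontriviality provides:
    \<open>f\<close> below a multiple of \<open>g\<close> excludes 0 at \<open>g\<close>, and
    \<open>g\<close> below a multiple of \<open>f\<close> excludes \<infinity>.\<close>
  obtain f where f: "f \<in> NV \<Lambda>" "\<psi> f \<noteq> 0" "\<psi> f \<noteq> \<infinity>"
    using assms unfolding nontrivial_state_def carrier_eq \<psi>_def by blast
  have "f \<noteq> 0" using f zero by auto
  have pos: "\<psi> g \<noteq> 0" if g: "g \<in> NV \<Lambda>" "g \<noteq> 0" for g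
  proof
    assume 0: "\<psi> g = 0"
    obtain n h where "h \<in> NV \<Lambda>" "(f + h, frag_cmul (int n) g) \<in> approx \<Lambda>"
      using dominated[OF f(1) g] by (auto simp: dominated_def)
    then have "\<psi> f + \<psi> h = 0" using approx[of "f + h"] add[OF f(1)] cmul[OF g(1)] 0 by simp
    then show False using f by simp
  qed
  have finite: "\<psi> g \<noteq> \<infinity>" if g: "g \<in> NV \<Lambda>" for g
  proof
    assume top: "\<psi> g = \<infinity>"
    obtain n h where "h \<in> NV \<Lambda>" "(g + h, frag_cmul (int n) f) \<in> approx \<Lambda>"
      using dominated[OF g f(1) \<open>f \<noteq> 0\<close>] by (auto simp: dominated_def)
    then have "\<psi> g + \<psi> h = of_nat n * \<psi> f" using approx[of "g + h"] add[OF g] cmul[OF f(1)] by simp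
    then have "of_nat n * \<psi> f = \<infinity>" using top by simp
    then show False using f(3) by (simp add: ennreal_mult_eq_top_iff)
  qed
  have "faithful_graph_trace \<Lambda> (\<lambda>v. enn2real (\<psi> (frag_of v)))"
    unfolding faithful_graph_trace_def
  proof (intro conjI ballI allI)
    fix v assume v: "v \<in> vertices \<Lambda>"
    show "0 < enn2real (\<psi> (frag_of v))"
      using pos[OF NV_frag_of[OF v]] finite[OF NV_frag_of[OF v]]
      by (simp add: enn2real_positive_iff less_top zero_less_iff_neq_zero)
    fix n
    have NV: "frag_of (sr \<Lambda> \<kappa>) \<in> NV \<Lambda>" if "\<kappa> \<in> paths_from_deg \<Lambda> v n" for \<kappa>
      using paths_from_degD(4)[OF that] by (rule NV_frag_of)
    have "\<psi> (frag_of v) = \<psi> (At \<Lambda> n (frag_of v))"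
      using approx[OF approx_At[OF NV_frag_of[OF v]]] by simp
    also have "\<dots> = (\<Sum>\<kappa>\<in>paths_from_deg \<Lambda> v n. \<psi> (frag_of (sr \<Lambda> \<kappa>)))"
      unfolding At_frag_of by (rule sum[OF NV])
    \<comment> \<open>\<open>enn2real\<close> passes through the sum because every summand is
      finite.\<close>
    finally show "enn2real (\<psi> (frag_of v)) = (\<Sum>\<kappa>\<in>paths_from_deg \<Lambda> v n. enn2real (\<psi> (frag_of (sr \<Lambda> \<kappa>))))"
      using NV finite by (simp add: enn2real_sum less_top)
  qed
  then show ?thesis by blast
qed

lemma coboundaries_imp_faithful_graph_trace:
  assumes pointed: "coboundaries \<inter> NV \<Lambda> = {0}"
  shows "\<exists>\<tau>. faithful_graph_trace \<Lambda> \<tau>"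
proof -
  obtain v\<^sub>0 where v0: "v\<^sub>0 \<in> vertices \<Lambda>" using vertex_exists by blast
  define u where "u = frag_of v\<^sub>0"
  have u: "u \<in> NV \<Lambda>" unfolding u_def by (rule NV_frag_of[OF v0])
  \<comment> \<open>The third summand makes \<open>u\<close> an order unit on the whole type, not only on \<open>ZV \<Lambda>\<close>.\<close>
  define K where "K = {g + h + z |g h z. g \<in> NV \<Lambda> \<and> h \<in> coboundaries \<and>
    Poly_Mapping.keys z \<inter> vertices \<Lambda> = {}}"
  have KI: "g + h + z \<in> K"
    if "g \<in> NV \<Lambda>" "h \<in> coboundaries" "Poly_Mapping.keys z \<inter> vertices \<Lambda> = {}" for g h z
    using that unfolding K_def by blast
  have K_zero: "0 \<in> K" using KI[of 0 0 0] coboundaries_zero by simp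
  have K_cob: "h \<in> K" if "h \<in> coboundaries" for h using KI[of 0 h 0] that by simp
  have K_NV: "g \<in> K" if "g \<in> NV \<Lambda>" for g using KI[of g 0 0] that coboundaries_zero by simp
  have K_add: "f + f' \<in> K" if K: "f \<in> K" "f' \<in> K" for f f'
  proof -
    obtain g h z where 1: "f = g + h + z" "g \<in> NV \<Lambda>" "h \<in> coboundaries"
      "Poly_Mapping.keys z \<inter> vertices \<Lambda> = {}" using K(1) by (auto simp: K_def)
    obtain g' h' z' where 2: "f' = g' + h' + z'" "g' \<in> NV \<Lambda>" "h' \<in> coboundaries"
      "Poly_Mapping.keys z' \<inter> vertices \<Lambda> = {}" using K(2) by (auto simp: K_def)
    have "Poly_Mapping.keys (z + z') \<inter> vertices \<Lambda> = {}"
      using Poly_Mapping.keys_add[of z z'] 1(4) 2(4) by blast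
    from KI[OF NV_add[OF 1(2) 2(2)] coboundaries_add[OF 1(3) 2(3)] this] show ?thesis
      by (simp add: 1(1) 2(1) ac_simps)
  qed
  have proper: "- frag_cmul (int n) u \<notin> K" if "0 < n" for n
  proof
    define a where "a = frag_cmul (int n) u"
    assume "- frag_cmul (int n) u \<in> K"
    then obtain g h z where *: "- a = g + h + z" "g \<in> NV \<Lambda>" "h \<in> coboundaries"
      "Poly_Mapping.keys z \<inter> vertices \<Lambda> = {}" unfolding K_def a_def by blast
    have a: "a \<in> NV \<Lambda>" unfolding a_def by (rule NV_cmul[OF u])
    \<comment> \<open>As a combination of elements of \<open>ZV\<close>, \<open>z\<close> is
      supported on vertices, and it also avoids them, so it vanishes. Then \<open>a + g\<close> is
      the coboundary \<open>- h\<close> and lies in the cone, where (4) applies.\<close>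
    have "z = - a - g - h" unfolding *(1) by simp
    moreover have "- a - g - h \<in> ZV \<Lambda>"
      using a *(2,3) by (simp only: ZV_diff ZV_uminus NV_ZV coboundaries_ZV)
    ultimately have "Poly_Mapping.keys z \<subseteq> vertices \<Lambda>" by (simp add: ZV_def)
    then have "z = 0" using *(4) keys_eq_empty by blast
    then have "- h = - (- a) + g" unfolding *(1) by simp
    then have "a + g \<in> coboundaries" using coboundaries_uminus[OF *(3)] by simp
    then have "a + g = 0" using pointed NV_add[OF a *(2)] by blast
    then have "a = 0" using NV_antisym[OF a *(2)] by blast
    then show False using \<open>0 < n\<close> by (simp add: a_def u_def)
  qed
  \<comment> \<open>Both signs are carried along because \<open>frag_induction\<close> works with
    differences: a bound for \<open>a - b\<close> needs one for \<open>a\<close> and one for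
    \<open>- b\<close>.\<close>
  have bounds: "(\<exists>m. frag_cmul m u - f \<in> K) \<and> (\<exists>m. frag_cmul m u + f \<in> K)" for f
  proof (rule frag_induction[of f UNIV])
    show "(\<exists>m. frag_cmul m u - 0 \<in> K) \<and> (\<exists>m. frag_cmul m u + 0 \<in> K)"
      using K_zero by (metis add_0 diff_0_right frag_cmul_zero)
  next
    fix w
    show "(\<exists>m. frag_cmul m u - frag_of w \<in> K) \<and> (\<exists>m. frag_cmul m u + frag_of w \<in> K)"
    proof (cases "w \<in> vertices \<Lambda>")
      case True
      obtain n h where h: "h \<in> NV \<Lambda>" "(frag_of w + h, frag_cmul (int n) u) \<in> approx \<Lambda>"
        using dominated_frag_of[OF v0 True] by (auto simp: dominated_def u_def)
      have "h + (frag_cmul (int n) u - (frag_of w + h)) \<in> K"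
        by (intro K_add K_NV K_cob h coboundaries_approx[OF approx_sym])
      then have "frag_cmul (int n) u - frag_of w \<in> K" by simp
      moreover have "frag_cmul 0 u + frag_of w \<in> K" using K_NV[OF NV_frag_of[OF True]] by simp
      ultimately show ?thesis by blast
    next
      case False
      then have "frag_of w \<in> K" "- frag_of w \<in> K"
        using KI[of 0 0 "frag_of w"] KI[of 0 0 "- frag_of w"] coboundaries_zero by (auto simp: keys_frag_of)
      then have "frag_cmul 0 u - frag_of w \<in> K" "frag_cmul 0 u + frag_of w \<in> K" by auto
      then show ?thesis by blast
    qed
  next
    fix a b
    assume "(\<exists>m. frag_cmul m u - a \<in> K) \<and> (\<exists>m. frag_cmul m u + a \<in> K)"
      "(\<exists>m. frag_cmul m u - b \<in> K) \<and> (\<exists>m. frag_cmul m u + b \<in> K)"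
    then obtain m m' n n' where "frag_cmul m u - a \<in> K" "frag_cmul m' u + a \<in> K"
      "frag_cmul n u - b \<in> K" "frag_cmul n' u + b \<in> K" by blast
    then have "(frag_cmul m u - a) + (frag_cmul n' u + b) \<in> K" "(frag_cmul m' u + a) + (frag_cmul n u - b) \<in> K"
      by (auto intro: K_add)
    moreover have "(frag_cmul m u - a) + (frag_cmul n' u + b) = frag_cmul (m + n') u - (a - b)"
      "(frag_cmul m' u + a) + (frag_cmul n u - b) = frag_cmul (m' + n) u + (a - b)"
      by (simp_all add: frag_cmul_distrib)
    ultimately have "frag_cmul (m + n') u - (a - b) \<in> K" "frag_cmul (m' + n) u + (a - b) \<in> K" by metis+
    then show "(\<exists>m. frag_cmul m u - (a - b) \<in> K) \<and> (\<exists>m. frag_cmul m u + (a - b) \<in> K)" by blast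
  qed auto
  obtain \<phi> :: "('a \<Rightarrow>\<^sub>0 int) \<Rightarrow> real"
    where \<phi>: "Modules.additive \<phi>" "\<And>f. f \<in> K \<Longrightarrow> 0 \<le> \<phi> f" "\<phi> u = 1"
    using exists_state[OF module_frag_cmul K_zero K_add proper] bounds by blast
  interpret Modules.additive \<phi> by (rule \<phi>(1))
  \<comment> \<open>Coboundaries lie in \<open>K\<close> together with their negatives, which makes
    the trace condition an equation and not just an inequality.\<close>
  have cob: "\<phi> h = 0" if "h \<in> coboundaries" for h
    using \<phi>(2)[OF K_cob[OF that]] \<phi>(2)[OF K_cob[OF coboundaries_uminus[OF that]]] by (simp add: minus)
  have "faithful_graph_trace \<Lambda> (\<lambda>v. \<phi> (frag_of v))"
    unfolding faithful_graph_trace_def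
  proof (intro conjI ballI allI)
    fix v assume v: "v \<in> vertices \<Lambda>"
    \<comment> \<open>Domination in the direction opposite to \<open>bounds\<close>:
      \<open>u\<close> lies below a multiple of \<open>v\<close>, so the normalization
      \<open>\<phi> u = 1\<close> excludes the value 0 at \<open>v\<close>.\<close>
    obtain n h where h: "h \<in> NV \<Lambda>" "(u + h, frag_cmul (int n) (frag_of v)) \<in> approx \<Lambda>"
      using dominated_frag_of[OF v v0] by (auto simp: dominated_def u_def)
    have "\<phi> (u + h) = \<phi> (frag_cmul (int n) (frag_of v))"
      using cob[OF coboundaries_approx[OF h(2)]] by (simp add: diff)
    then have "1 \<le> real n * \<phi> (frag_of v)"
      using \<phi>(2)[OF K_NV[OF h(1)]] by (simp add: additive_frag_cmul[OF \<phi>(1)] add \<phi>(3))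
    moreover have "0 \<le> \<phi> (frag_of v)" by (rule \<phi>(2)[OF K_NV[OF NV_frag_of[OF v]]])
    ultimately show "0 < \<phi> (frag_of v)" by (cases "\<phi> (frag_of v) = 0") auto
    fix n
    have "\<phi> (frag_of v) = \<phi> (At \<Lambda> n (frag_of v))"
      using cob[OF coboundaries_At[OF NV_ZV[OF NV_frag_of[OF v]]]] by (simp add: diff)
    then show "\<phi> (frag_of v) = (\<Sum>\<kappa>\<in>paths_from_deg \<Lambda> v n. \<phi> (frag_of (sr \<Lambda> \<kappa>)))"
      by (simp add: At_frag_of sum)
  qed
  then show ?thesis by blast
qed

end

theorem proposition6p8:
  fixes \<Lambda> :: "('a, 'k::finite) kgraph_data"
  defines "S \<equiv> graph_semigroup \<Lambda>"
  assumes "kgraph \<Lambda>" and "row_finite \<Lambda>" and "kgraph_cofinal \<Lambda>" and "no_sources \<Lambda>"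
  shows "(stably_finite S \<longleftrightarrow>
            (\<forall>x \<in> carrier S. \<forall>n::nat. x \<noteq> \<one>\<^bsub>S\<^esub> \<longrightarrow> \<not> (x [^]\<^bsub>S\<^esub> (n + 1) \<preceq>\<^bsub>S\<^esub> x [^]\<^bsub>S\<^esub> n))) \<and>
         (stably_finite S \<longleftrightarrow> (\<exists>\<phi>. nontrivial_state S \<phi>)) \<and>
         (stably_finite S \<longleftrightarrow> (\<Sum>i\<in>UNIV. im_one_minus_At \<Lambda> i) \<inter> NV \<Lambda> = {0}) \<and>
         (stably_finite S \<longleftrightarrow> (\<exists>\<tau>. faithful_graph_trace \<Lambda> \<tau>))"
proof -
  interpret kgraph \<Lambda> by fact
  interpret cofinal_kgraph \<Lambda> by unfold_locales fact+
  have "(\<Sum>i\<in>UNIV. im_one_minus_At \<Lambda> i) \<inter> NV \<Lambda> = {0}" if "stably_finite S"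
    using stably_finite_imp_coboundaries that unfolding S_def .
  moreover have "\<exists>\<tau>. faithful_graph_trace \<Lambda> \<tau>" if "(\<Sum>i\<in>UNIV. im_one_minus_At \<Lambda> i) \<inter> NV \<Lambda> = {0}"
    using coboundaries_imp_faithful_graph_trace[OF that] .
  moreover have "\<forall>x \<in> carrier S. \<forall>n::nat. x \<noteq> \<one>\<^bsub>S\<^esub> \<longrightarrow> \<not> (x [^]\<^bsub>S\<^esub> (n + 1) \<preceq>\<^bsub>S\<^esub> x [^]\<^bsub>S\<^esub> n)"
    if "\<exists>\<tau>. faithful_graph_trace \<Lambda> \<tau>"
    using that faithful_graph_trace_imp_pow_not_prec unfolding S_def by blast
  moreover have "stably_finite S"
    if "\<forall>x \<in> carrier S. \<forall>n::nat. x \<noteq> \<one>\<^bsub>S\<^esub> \<longrightarrow> \<not> (x [^]\<^bsub>S\<^esub> (n + 1) \<preceq>\<^bsub>S\<^esub> x [^]\<^bsub>S\<^esub> n)"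
    using that pow_not_prec_imp_stably_finite unfolding S_def by blast
  moreover have "\<exists>\<phi>. nontrivial_state S \<phi>" if "\<exists>\<tau>. faithful_graph_trace \<Lambda> \<tau>"
    using that faithful_graph_trace_imp_state unfolding S_def by blast
  moreover have "\<exists>\<tau>. faithful_graph_trace \<Lambda> \<tau>" if "\<exists>\<phi>. nontrivial_state S \<phi>"
    using that state_imp_faithful_graph_trace unfolding S_def by blast
  ultimately show ?thesis by blast
qed

end
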